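(* Let $\mathcal H$ be a separable (complex) Hilbert space, let $\mathcal P$ be the set of orthogonal projections on $\mathcal H$, and let $\rho$ be the length metric on $\mathcal P$ induced by the operator norm metric $d(P,Q)=\|P-Q\|$. Then the metric space $(\mathcal P,\rho)$ is $\frac{\pi}{2}$-geodesic. Moreover, for $P,Q\in\mathcal P$ one has $\rho(P,Q)<\frac{\pi}{2}$ if and only if $\|P-Q\|<1$, and in that case $$\rho(P,Q)=\arcsin(\|P-Q\|).$$ In particular, in that case $\operatorname{Ran}Q$ is a graph subspace with respect to the orthogonal decomposition $\mathcal H=\operatorname{Ran}P\oplus\operatorname{Ran}P^\perp$, and $$\rho(P,Q)=\|\Theta\|,$$ where $\Theta$ is the operator angle between $\operatorname{Ran}Q$ and $\operatorname{Ran}P$.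
   Context: $\mathcal P=\{P\in\mathcal L(\mathcal H)\mid P=P^*=P^2\}$, where $\mathcal L(\mathcal H)$ denotes the bounded operators on $\mathcal H$; $P^\perp=I-P$. For a path $\gamma:[a,b]\to\mathcal P$ continuous in operator norm, its length is $l(\gamma)=\sup\sum_{j=0}^{n-1}\|\gamma(t_{j+1})-\gamma(t_j)\|$, the supremum being over all $n\in\mathbb N$ and partitions $a=t_0<\dots<t_n=b$; $\gamma$ is rectifiable if $l(\gamma)<\infty$. The length metric $\rho(P,Q)\in[0,\infty]$ is the infimum of the lengths of rectifiable paths in $\mathcal P$ from $P$ to $Q$, and $\rho(P,Q)=\infty$ if there are none. A geodesic path in a metric space $(X,\rho)$ joining $x$ to $y$ is a map $\gamma:[0,l]\to X$ with $\gamma(0)=x$, $\gamma(l)=y$ and $\rho(\gamma(t),\gamma(s))=|t-s|$ for all $s,t\in[0,l]$. The space $(X,\rho)$ is $r$-geodesic if every pair $x,y\in X$ with $\rho(x,y)<r$ is joined by a geodesic path. $\operatorname{Ran}Q$ is a graph subspace with respect to $\mathcal H=\operatorname{Ran}P\oplus\operatorname{Ran}P^\perp$ if there is a bounded operator $X:\operatorname{Ran}P\to\operatorname{Ran}P^\perp$ (the angular operator) with $\operatorname{Ran}Q=\{x_0\oplus Xx_0\mid x_0\in\operatorname{Ran}P\}$. In this case the operator angle is $\Theta=\arctan\sqrt{X^*X}$, a bounded self-adjoint operator on $\operatorname{Ran}P$ defined by functional calculus. *)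

theory Defs
  imports "HOL-Analysis.Analysis" "HOL-Computational_Algebra.Polynomial"
begin

section \<open>Complex Hilbert spaces and their bounded operators\<close>

text \<open>
  A complex inner product space is built on top of its underlying real inner product space, whose
  inner product is the real part of the complex one; norm and topology are thus the usual ones.
  The complex inner product is linear in its second argument.
\<close>

class complex_inner = real_inner +
  fixes scaleC :: "complex \<Rightarrow> 'a \<Rightarrow> 'a" (infixr \<open>*\<^sub>C\<close> 75)
    and cinner :: "'a \<Rightarrow> 'a \<Rightarrow> complex"
  assumes scaleC_add_right: "c *\<^sub>C (x + y) = c *\<^sub>C x + c *\<^sub>C y"
    and scaleC_add_left: "(c + d) *\<^sub>C x = c *\<^sub>C x + d *\<^sub>C x"
    and scaleC_scaleC: "c *\<^sub>C (d *\<^sub>C x) = (c * d) *\<^sub>C x"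
    and scaleC_of_real: "complex_of_real r *\<^sub>C x = r *\<^sub>R x"
    and cinner_commute: "cinner x y = cnj (cinner y x)"
    and cinner_add_right: "cinner x (y + z) = cinner x y + cinner x z"
    and cinner_scaleC_right: "cinner x (c *\<^sub>C y) = c * cinner x y"
    and inner_eq_Re_cinner: "inner x y = Re (cinner x y)"

class chilbert_space = complex_inner + complete_space

text \<open>
  The library type of bounded operators only knows real linearity, so that complex homogeneity is
  added as a predicate. The norm of this type is the operator norm.
\<close>

definition complex_homogeneous :: "('a::chilbert_space \<Rightarrow>\<^sub>L 'a) \<Rightarrow> bool" where
  "complex_homogeneous T \<longleftrightarrow> (\<forall>c x. T (c *\<^sub>C x) = c *\<^sub>C T x)"

definition cadjoint :: "('a::chilbert_space \<Rightarrow>\<^sub>L 'a) \<Rightarrow> ('a \<Rightarrow>\<^sub>L 'a)" where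
  "cadjoint T = (THE S. \<forall>x y. cinner (blinfun_apply S x) y = cinner x (T y))"

definition orth_projections :: "('a::chilbert_space \<Rightarrow>\<^sub>L 'a) set" where
  "orth_projections = {P. complex_homogeneous P \<and> P = cadjoint P \<and> P = P o\<^sub>L P}"

definition perp :: "('a::chilbert_space \<Rightarrow>\<^sub>L 'a) \<Rightarrow> ('a \<Rightarrow>\<^sub>L 'a)" where
  "perp P = id_blinfun - P"

section \<open>Length metric and geodesics\<close>

definition path_length :: "real \<Rightarrow> real \<Rightarrow> (real \<Rightarrow> 'b::real_normed_vector) \<Rightarrow> ennreal" where
  "path_length a b \<gamma> =
     Sup {(\<Sum>j<n. ennreal (norm (\<gamma> (t (Suc j)) - \<gamma> (t j)))) | n t.
            t 0 = a \<and> t n = b \<and> (\<forall>j<n. t j < t (Suc j))}"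

definition length_metric :: "'b::real_normed_vector set \<Rightarrow> 'b \<Rightarrow> 'b \<Rightarrow> ennreal" where
  "length_metric X x y =
     Inf {path_length a b \<gamma> | a b \<gamma>.
            a \<le> b \<and> continuous_on {a..b} \<gamma> \<and> \<gamma> ` {a..b} \<subseteq> X \<and> \<gamma> a = x \<and> \<gamma> b = y \<and>
            path_length a b \<gamma> < \<infinity>}"

definition geodesic_path ::
  "'b set \<Rightarrow> ('b \<Rightarrow> 'b \<Rightarrow> ennreal) \<Rightarrow> 'b \<Rightarrow> 'b \<Rightarrow> real \<Rightarrow> (real \<Rightarrow> 'b) \<Rightarrow> bool" where
  "geodesic_path X d x y l \<gamma> \<longleftrightarrow>
     0 \<le> l \<and> \<gamma> ` {0..l} \<subseteq> X \<and> \<gamma> 0 = x \<and> \<gamma> l = y \<and>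
     (\<forall>s\<in>{0..l}. \<forall>t\<in>{0..l}. d (\<gamma> t) (\<gamma> s) = ennreal \<bar>t - s\<bar>)"

definition r_geodesic :: "ennreal \<Rightarrow> 'b set \<Rightarrow> ('b \<Rightarrow> 'b \<Rightarrow> ennreal) \<Rightarrow> bool" where
  "r_geodesic r X d \<longleftrightarrow>
     (\<forall>x\<in>X. \<forall>y\<in>X. d x y < r \<longrightarrow> (\<exists>l \<gamma>. geodesic_path X d x y l \<gamma>))"

abbreviation projection_dist :: "('a::chilbert_space \<Rightarrow>\<^sub>L 'a) \<Rightarrow> ('a \<Rightarrow>\<^sub>L 'a) \<Rightarrow> ennreal" (\<open>\<rho>\<close>) where
  "\<rho> \<equiv> length_metric orth_projections"

section \<open>Operators between closed subspaces and functional calculus\<close>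

text \<open>
  For orthogonal projections \<open>E\<close> and \<open>F\<close>, a bounded operator from \<open>Ran E\<close> to \<open>Ran F\<close> is
  represented by its extension by zero to the orthogonal complement of \<open>Ran E\<close>. This
  identification preserves norms, products and adjoints; the identity operator of \<open>Ran E\<close> becomes
  \<open>E\<close>. Hence spectra, powers and the functional calculus on \<open>Ran E\<close> are taken relative to the
  unit \<open>E\<close>.
\<close>

definition subspace_ops ::
  "('a::chilbert_space \<Rightarrow>\<^sub>L 'a) \<Rightarrow> ('a \<Rightarrow>\<^sub>L 'a) \<Rightarrow> ('a \<Rightarrow>\<^sub>L 'a) set" where
  "subspace_ops E F = {T. complex_homogeneous T \<and> F o\<^sub>L T o\<^sub>L E = T}"

definition spectrum_on :: "('a::chilbert_space \<Rightarrow>\<^sub>L 'a) \<Rightarrow> ('a \<Rightarrow>\<^sub>L 'a) \<Rightarrow> complex set" where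
  "spectrum_on E T =
     {z. \<not> (\<exists>S\<in>subspace_ops E E. \<forall>x\<in>range E.
              S (T x - z *\<^sub>C x) = x \<and> T (S x) - z *\<^sub>C S x = x)}"

primrec op_power_on ::
  "('a::chilbert_space \<Rightarrow>\<^sub>L 'a) \<Rightarrow> ('a \<Rightarrow>\<^sub>L 'a) \<Rightarrow> nat \<Rightarrow> ('a \<Rightarrow>\<^sub>L 'a)" where
  "op_power_on E T 0 = E"
| "op_power_on E T (Suc n) = T o\<^sub>L op_power_on E T n"

definition op_poly_on ::
  "('a::chilbert_space \<Rightarrow>\<^sub>L 'a) \<Rightarrow> real poly \<Rightarrow> ('a \<Rightarrow>\<^sub>L 'a) \<Rightarrow> ('a \<Rightarrow>\<^sub>L 'a)" where
  "op_poly_on E p T = (\<Sum>i\<le>degree p. coeff p i *\<^sub>R op_power_on E T i)"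

text \<open>
  Continuous functional calculus for a bounded self-adjoint operator \<open>T\<close> on \<open>Ran E\<close>: the operator
  \<open>f(T)\<close> is the norm limit of \<open>p\<^sub>n(T)\<close> for polynomials \<open>p\<^sub>n\<close> converging to \<open>f\<close> uniformly on the
  spectrum of \<open>T\<close>, which consists of real numbers.
\<close>

definition fun_calc_on ::
  "('a::chilbert_space \<Rightarrow>\<^sub>L 'a) \<Rightarrow> (real \<Rightarrow> real) \<Rightarrow> ('a \<Rightarrow>\<^sub>L 'a) \<Rightarrow> ('a \<Rightarrow>\<^sub>L 'a)" where
  "fun_calc_on E f T =
     (THE B. \<exists>p :: nat \<Rightarrow> real poly.
        uniform_limit {t. complex_of_real t \<in> spectrum_on E T} (\<lambda>n. poly (p n)) f sequentially \<and>
        (\<lambda>n. op_poly_on E (p n) T) \<longlonglongrightarrow> B)"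

section \<open>Graph subspaces and the operator angle\<close>

definition is_angular_operator ::
  "('a::chilbert_space \<Rightarrow>\<^sub>L 'a) \<Rightarrow> ('a \<Rightarrow>\<^sub>L 'a) \<Rightarrow> ('a \<Rightarrow>\<^sub>L 'a) \<Rightarrow> bool" where
  "is_angular_operator P Q X \<longleftrightarrow>
     X \<in> subspace_ops P (perp P) \<and> range Q = {x + X x | x. x \<in> range P}"

definition is_graph_subspace ::
  "('a::chilbert_space \<Rightarrow>\<^sub>L 'a) \<Rightarrow> ('a \<Rightarrow>\<^sub>L 'a) \<Rightarrow> bool" where
  "is_graph_subspace P Q \<longleftrightarrow> (\<exists>X. is_angular_operator P Q X)"

definition angular_operator ::
  "('a::chilbert_space \<Rightarrow>\<^sub>L 'a) \<Rightarrow> ('a \<Rightarrow>\<^sub>L 'a) \<Rightarrow> ('a \<Rightarrow>\<^sub>L 'a)" where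
  "angular_operator P Q = (THE X. is_angular_operator P Q X)"

definition operator_angle ::
  "('a::chilbert_space \<Rightarrow>\<^sub>L 'a) \<Rightarrow> ('a \<Rightarrow>\<^sub>L 'a) \<Rightarrow> ('a \<Rightarrow>\<^sub>L 'a)" where
  "operator_angle P Q =
     (let X = angular_operator P Q
      in fun_calc_on P arctan (fun_calc_on P sqrt (cadjoint X o\<^sub>L X)))"

end

theory Submission
  imports Defs "HOL-Computational_Algebra.Fundamental_Theorem_Algebra"
begin

text \<open>
  Lower bound: \<open>arcsin (norm (P - Q))\<close> satisfies the triangle inequality on projections, because a unit
  vector of \<open>Ran R\<close> at angle \<open>\<beta>\<close> from \<open>Ran Q\<close> is at angle at most \<open>\<alpha> + \<beta>\<close> from \<open>Ran P\<close> when \<open>\<alpha>\<close> is the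
  angle of \<open>P\<close> and \<open>Q\<close>. As \<open>arcsin u \<sim> u\<close> near 0, refining partitions shows that every path from \<open>P\<close>
  to \<open>Q\<close> has at least this length.

  Upper bound: if \<open>norm (P - Q) < 1\<close>, then \<open>C = (P - Q)\<^sup>2\<close> commutes with \<open>P\<close> and \<open>Q\<close> and has its spectrum in
  \<open>{0..norm (P - Q) ^ 2}\<close>. Writing \<open>C = sin \<Phi> ^ 2\<close>, the rotation of \<open>Ran P\<close> by \<open>t \<Phi>\<close> towards \<open>Ran Q\<close> is an
  explicit expression in \<open>P\<close>, \<open>Q\<close> and functions of \<open>C\<close>, and it is a Lipschitz path with constant
  \<open>arcsin (norm (P - Q))\<close>. The triangle inequality forces it to be a geodesic. The angular operator is
  \<open>(I - P) Q (I - C)\<^sup>-\<^sup>1 P\<close>, and its norm is the tangent of \<open>arcsin (norm (P - Q))\<close>.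

  The functional calculus rests on a norm bound for real polynomials \<open>p\<close> of a self-adjoint operator
  \<open>T\<close>: the operator \<open>p(T)\<^sup>2 - norm (p(T)) ^ 2\<close> is not bounded below, hence by the fundamental theorem of
  algebra neither is \<open>T - t\<close> for some real root \<open>t\<close> of \<open>p\<^sup>2 - norm (p(T)) ^ 2\<close>. Only this approximate point
  spectrum is needed for the estimates.
\<close>

section \<open>Complex inner product spaces\<close>

\<comment> \<open>Makes the space of bounded operators complete, so that the Cauchy sequences of
  operators in the functional calculus have limits.\<close>
subclass (in chilbert_space) banach ..

lemma inner_scaleC_left: "inner (c *\<^sub>C x) y = inner x (cnj c *\<^sub>C (y::'a::complex_inner))"
  by (simp add: inner_eq_Re_cinner cinner_scaleC_right cinner_commute[of "c *\<^sub>C x" y] cinner_commute[of y x])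

lemma Im_cinner: "Im (cinner x y) = inner x ((-\<i>) *\<^sub>C (y::'a::complex_inner))"
  by (simp add: inner_eq_Re_cinner cinner_scaleC_right)

text \<open>Multiplying the second argument by \<open>-\<i>\<close> turns an imaginary part into a
  real part, so the real inner product determines the complex one. This lets nearly all later
  arguments use \<open>inner\<close> alone.\<close>

lemma cinner_eqI:
  fixes x y :: "'a::complex_inner"
  assumes "\<And>c. inner x (c *\<^sub>C y) = inner z (c *\<^sub>C w)"
  shows "cinner x y = cinner z w"
proof (rule complex_eqI)
  show "Re (cinner x y) = Re (cinner z w)"
    using assms[of 1] scaleC_of_real[of 1 y] scaleC_of_real[of 1 w] by (simp add: inner_eq_Re_cinner)
  show "Im (cinner x y) = Im (cinner z w)"
    using assms[of "-\<i>"] by (simp only: Im_cinner)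
qed

lemma norm_scaleC: "norm (c *\<^sub>C x) = cmod c * norm (x::'a::complex_inner)"
proof -
  have "inner (c *\<^sub>C x) (c *\<^sub>C x) = inner x (complex_of_real ((cmod c)\<^sup>2) *\<^sub>C x)"
    by (simp add: inner_scaleC_left scaleC_scaleC complex_norm_square mult.commute del: of_real_power)
  then have "(norm (c *\<^sub>C x))\<^sup>2 = (cmod c * norm x)\<^sup>2"
    by (simp only: scaleC_of_real) (simp add: power2_norm_eq_inner power_mult_distrib)
  then show ?thesis by simp
qed

lemma scaleC_one [simp]: "1 *\<^sub>C x = (x::'a::complex_inner)"
  using scaleC_of_real[of 1 x] by simp

lemma scaleC_zero_left [simp]: "0 *\<^sub>C x = (0::'a::complex_inner)"
  using scaleC_of_real[of 0 x] by simp

lemma scaleC_zero_right [simp]: "c *\<^sub>C 0 = (0::'a::complex_inner)"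
  using norm_scaleC[of c "0::'a"] by simp

lemma scaleC_minus_left: "(- c) *\<^sub>C x = - (c *\<^sub>C (x::'a::complex_inner))"
  using scaleC_add_left[of c "-c" x] by (simp add: eq_neg_iff_add_eq_0 add.commute)

lemma scaleC_scaleR: "c *\<^sub>C (r *\<^sub>R x) = r *\<^sub>R (c *\<^sub>C (x::'a::complex_inner))"
  by (simp add: scaleC_of_real[symmetric] scaleC_scaleC mult.commute)

lemma scaleC_minus_right: "c *\<^sub>C (- x) = - (c *\<^sub>C (x::'a::complex_inner))"
  using scaleC_scaleR[of c "-1" x] by simp

lemma scaleC_diff_right: "c *\<^sub>C (x - y) = c *\<^sub>C x - c *\<^sub>C (y::'a::complex_inner)"
  using scaleC_add_right[of c x "-y"] by (simp add: scaleC_minus_right)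

lemma bounded_linear_scaleC: "bounded_linear (\<lambda>x::'a::complex_inner. c *\<^sub>C x)"
  by (rule bounded_linear_intro[where K="cmod c"])
    (auto simp: scaleC_add_right scaleC_scaleR norm_scaleC mult.commute)

section \<open>Riesz representation, adjoints and orthogonal projections\<close>

text \<open>The representing vector minimises \<open>norm x ^ 2 - 2 * f x\<close>; minimising sequences are Cauchy by the
  parallelogram law.\<close>

lemma riesz_representation:
  fixes f :: "'a::{real_inner,complete_space} \<Rightarrow> real"
  assumes "bounded_linear f"
  obtains z where "\<And>x. f x = inner z x"
proof -
  interpret f: bounded_linear f by fact
  define \<phi> where "\<phi> = (\<lambda>x. (norm x)\<^sup>2 - 2 * f x)"
  obtain K where K: "\<And>x. norm (f x) \<le> norm x * K" using f.bounded by blast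
  \<comment> \<open>Completing the square: the bound on \<open>f\<close> gives
    \<open>\<phi> x >= (norm x - K) ^ 2 - K ^ 2\<close>.\<close>
  have lower: "- K\<^sup>2 \<le> \<phi> x" for x
  proof -
    have "f x \<le> norm x * K" using K[of x] by simp
    moreover have "0 \<le> (norm x - K)\<^sup>2" by simp
    ultimately show ?thesis unfolding \<phi>_def by (simp add: power2_diff)
  qed
  define \<mu> where "\<mu> = Inf (range \<phi>)"
  have bdd: "bdd_below (range \<phi>)" using lower by (auto intro: bdd_belowI2[where m="- K\<^sup>2"])
  have \<mu>_le: "\<mu> \<le> \<phi> x" for x unfolding \<mu>_def by (rule cInf_lower) (use bdd in auto)
  define r where "r = (\<lambda>n. 1 / real (Suc n))"
  have r: "r \<longlonglongrightarrow> 0" unfolding r_def by (rule LIMSEQ_Suc[OF lim_1_over_n])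
  have r_pos: "0 < r n" for n by (simp add: r_def)
  have r_mono: "r n \<le> r N" if "N \<le> n" for n N using that by (simp add: r_def frac_le)
  have "\<exists>x. \<phi> x < \<mu> + r n" for n
    using cInf_lessD[of "range \<phi>" "\<mu> + r n"] r_pos[of n] unfolding \<mu>_def by auto
  then obtain x where x: "\<And>n. \<phi> (x n) < \<mu> + r n" by metis
  \<comment> \<open>Parallelogram law; the linear terms cancel because \<open>f\<close> at the
    midpoint is the mean of its values.\<close>
  have par: "(norm (u - v))\<^sup>2 = 2 * (\<phi> u + \<phi> v - 2 * \<phi> ((1/2) *\<^sub>R (u + v)))" for u v
    unfolding \<phi>_def power2_norm_eq_inner
    by (simp add: f.add f.scaleR inner_add inner_diff inner_commute algebra_simps)
  have arith: "p \<le> 4 * q" if "p = 2 * (a + b - 2 * c)" "a < \<mu> + q1" "b < \<mu> + q2" "\<mu> \<le> c" "q1 \<le> q" "q2 \<le> q"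
    for p a b c q q1 q2 :: real using that by argo
  have dist: "(norm (x m - x n))\<^sup>2 \<le> 4 * r N" if "N \<le> m" "N \<le> n" for m n N
    by (rule arith[OF par x x \<mu>_le r_mono[OF that(1)] r_mono[OF that(2)]])
  have "Cauchy x"
  proof (rule metric_CauchyI)
    fix e :: real assume e: "0 < e"
    have "\<forall>\<^sub>F n in sequentially. r n < e\<^sup>2 / 4" using order_tendstoD(2)[OF r, of "e\<^sup>2 / 4"] e by simp
    then obtain N where N: "r N < e\<^sup>2 / 4" by (auto simp: eventually_sequentially)
    have "norm (x m - x n) < e" if "N \<le> m" "N \<le> n" for m n
    proof -
      have "(norm (x m - x n))\<^sup>2 < e\<^sup>2" using dist[OF that] N by linarith
      then show ?thesis by (rule power2_less_imp_less) (use e in simp)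
    qed
    then show "\<exists>M. \<forall>m\<ge>M. \<forall>n\<ge>M. dist (x m) (x n) < e" by (auto simp: dist_norm)
  qed
  then obtain z where z: "x \<longlonglongrightarrow> z" using Cauchy_convergent convergent_def by blast
  have "(\<lambda>n. \<phi> (x n)) \<longlonglongrightarrow> \<phi> z" unfolding \<phi>_def by (intro tendsto_intros z f.tendsto)
  moreover have "(\<lambda>n. \<mu> + r n) \<longlonglongrightarrow> \<mu> + 0"
    by (intro tendsto_intros r)
  ultimately have "\<phi> z \<le> \<mu> + 0" by (rule LIMSEQ_le) (use x less_imp_le in blast)
  then have min: "\<phi> z \<le> \<phi> y" for y using \<mu>_le[of y] by simp
  have "f h = inner z h" for h
  proof (rule ccontr)
    assume ne: "f h \<noteq> inner z h"
    define a where "a = f h - inner z h"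
    have "h \<noteq> 0" using ne by (auto simp: f.zero)
    then have h: "0 < (norm h)\<^sup>2" by simp
    \<comment> \<open>The minimiser of the quadratic polynomial that \<open>\<phi>\<close> becomes
      along the line through \<open>z\<close> in direction \<open>h\<close>.\<close>
    define t where "t = a / (norm h)\<^sup>2"
    have "\<phi> (z + t *\<^sub>R h) = \<phi> z - 2 * t * a + t\<^sup>2 * (norm h)\<^sup>2"
      unfolding \<phi>_def power2_norm_eq_inner a_def
      by (simp add: f.add f.scaleR inner_add inner_commute algebra_simps power2_eq_square)
    also have "\<dots> = \<phi> z - a\<^sup>2 / (norm h)\<^sup>2"
      using h by (simp add: t_def power2_eq_square field_simps)
    also have "\<dots> < \<phi> z" using ne h by (simp add: a_def)
    finally show False using min[of "z + t *\<^sub>R h"] by simp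
  qed
  then show thesis using that by blast
qed

section \<open>Symmetric operators and adjoints\<close>

definition symmetric_op :: "('a::real_inner \<Rightarrow>\<^sub>L 'a) \<Rightarrow> bool" where
  "symmetric_op T \<longleftrightarrow> (\<forall>x y. inner (T x) y = inner x (T y))"

lemma symmetric_opD: "symmetric_op T \<Longrightarrow> inner (T x) y = inner x (T y)"
  by (simp add: symmetric_op_def)

lemma inner_ext:
  fixes x y :: "'a::real_inner"
  assumes "\<And>z. inner x z = inner y z"
  shows "x = y"
  using assms[of "x - y"] by (metis diff_eq_diff_eq diff_self eq_iff_diff_eq_0 inner_diff_left inner_eq_zero_iff)

text \<open>Test with \<open>y = s x\<close> and cancel one factor. Here \<open>s\<close> is a bare
  function because this estimate is what shows it to be bounded in
  \<open>exists_adjoint\<close>.\<close>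

lemma norm_adjoint_apply_le:
  fixes T :: "'a::real_inner \<Rightarrow>\<^sub>L 'a"
  assumes "\<And>x y. inner (s x) y = inner x (T y)"
  shows "norm (s x) \<le> norm x * norm T"
proof (cases "norm (s x) = 0")
  case False
  have "norm (s x) * norm (s x) = inner x (T (s x))"
    by (simp add: assms[symmetric] power2_norm_eq_inner[symmetric] power2_eq_square)
  also have "\<dots> \<le> norm x * (norm T * norm (s x))"
    by (meson Cauchy_Schwarz_ineq2 abs_le_D1 mult_left_mono norm_blinfun norm_ge_zero order_trans)
  finally show ?thesis using False by (simp add: mult.assoc[symmetric])
qed simp

text \<open>Riesz representation of the functional \<open>inner x (T y)\<close> in \<open>y\<close>;
  linearity in \<open>x\<close> follows because the representing vector is unique.\<close>

lemma exists_adjoint: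
  fixes T :: "'a::{real_inner,complete_space} \<Rightarrow>\<^sub>L 'a"
  obtains S :: "'a \<Rightarrow>\<^sub>L 'a" where "\<And>x y. inner (S x) y = inner x (T y)"
proof -
  have "\<exists>z. \<forall>y. inner x (T y) = inner z y" for x
  proof -
    have "bounded_linear (\<lambda>y. inner x (T y))"
      by (rule bounded_linear_compose[OF bounded_linear_inner_right blinfun.bounded_linear_right])
    then show ?thesis by (rule riesz_representation) blast
  qed
  then obtain s where s: "\<And>x y. inner (s x) y = inner x (T y)" by metis
  have "bounded_linear s"
  proof (rule bounded_linear_intro[where K="norm T"])
    show "s (x + y) = s x + s y" for x y by (rule inner_ext) (simp add: s inner_add_left)
    show "s (r *\<^sub>R x) = r *\<^sub>R s x" for r x by (rule inner_ext) (simp add: s)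
    show "norm (s x) \<le> norm x * norm T" for x by (rule norm_adjoint_apply_le) (rule s)
  qed
  then have "blinfun_apply (Blinfun s) = s" by (rule bounded_linear_Blinfun_apply)
  then show thesis using that[of "Blinfun s"] s by simp
qed

lemma complex_homogeneousD: "complex_homogeneous T \<Longrightarrow> T (c *\<^sub>C x) = c *\<^sub>C T x"
  by (simp add: complex_homogeneous_def)

lemma cinner_adjointI:
  assumes "complex_homogeneous T" "\<And>x y. inner (S x) y = inner x (T y)"
  shows "cinner (S x) y = cinner x (T y)"
  by (rule cinner_eqI) (metis assms complex_homogeneousD)

text \<open>Resolves the definite description in \<open>cadjoint\<close>. For complex homogeneous
  \<open>T\<close> the real adjoint is already the complex one, so checking \<open>inner\<close> is
  enough.\<close>

lemma cadjoint_eqI: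
  assumes "complex_homogeneous T" "\<And>x y. inner (blinfun_apply S x) y = inner x (T y)"
  shows "cadjoint T = S"
  unfolding cadjoint_def
proof (rule the_equality)
  show "\<forall>x y. cinner (S x) y = cinner x (T y)" using cinner_adjointI[OF assms] by blast
  fix S' assume S': "\<forall>x y. cinner (blinfun_apply S' x) y = cinner x (T y)"
  show "S' = S"
    by (rule blinfun_eqI, rule inner_ext) (metis assms(2) inner_eq_Re_cinner S')
qed

lemma inner_cadjoint:
  assumes "complex_homogeneous T"
  shows "inner (cadjoint T x) y = inner x (T y)"
  using assms by (metis cadjoint_eqI exists_adjoint)

lemma inner_cadjoint_right:
  assumes "complex_homogeneous T"
  shows "inner x (cadjoint T y) = inner (T x) y"
  using inner_cadjoint[OF assms, of y x] by (simp add: inner_commute)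

lemma complex_homogeneous_cadjoint:
  assumes "complex_homogeneous T"
  shows "complex_homogeneous (cadjoint T)"
  unfolding complex_homogeneous_def
  by (intro allI, rule inner_ext) (simp add: inner_cadjoint inner_scaleC_left assms complex_homogeneousD)

lemma norm_adjoint_le:
  fixes S T :: "'a::real_inner \<Rightarrow>\<^sub>L 'a"
  assumes "\<And>x y. inner (blinfun_apply S x) y = inner x (blinfun_apply T y)"
  shows "norm S \<le> norm T"
  by (rule norm_blinfun_bound) (use norm_adjoint_apply_le[of S T, OF assms] in \<open>simp_all add: mult.commute\<close>)

text \<open>The working form of the definition: the adjoint equation becomes symmetry for the real
  inner product.\<close>

lemma orth_projections_iff:
  "P \<in> orth_projections \<longleftrightarrow> complex_homogeneous P \<and> symmetric_op P \<and> (\<forall>x. P (P x) = P x)"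
proof -
  have "P = cadjoint P \<longleftrightarrow> symmetric_op P" if "complex_homogeneous P"
    using that inner_cadjoint[OF that] cadjoint_eqI[OF that, of P] by (auto simp: symmetric_op_def)
  moreover have "P = P o\<^sub>L P \<longleftrightarrow> (\<forall>x. P (P x) = P x)"
    by (metis blinfun_eqI blinfun_apply_blinfun_compose)
  ultimately show ?thesis unfolding orth_projections_def by blast
qed

section \<open>Polynomials in an operator\<close>

text \<open>Padding with zero coefficients puts polynomials of different degrees over a common index
  range.\<close>

lemma op_poly_on_atMost:
  assumes "degree p \<le> n"
  shows "op_poly_on E p T = (\<Sum>i\<le>n. coeff p i *\<^sub>R op_power_on E T i)"
  unfolding op_poly_on_def
  by (rule sum.mono_neutral_left) (use assms in \<open>auto simp: coeff_eq_0\<close>)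

lemma op_poly_on_zero [simp]: "op_poly_on E 0 T = 0"
  by (simp add: op_poly_on_def)

lemma op_poly_on_pCons: "op_poly_on E (pCons a p) T = a *\<^sub>R E + (T o\<^sub>L op_poly_on E p T)"
  unfolding op_poly_on_atMost[OF degree_pCons_le] op_poly_on_def
  by (simp add: sum.atMost_Suc_shift bounded_bilinear.sum_right[OF bounded_bilinear_blinfun_compose]
      bounded_bilinear.scaleR_right[OF bounded_bilinear_blinfun_compose] del: sum.atMost_Suc)

lemma op_poly_on_add: "op_poly_on E (p + q) T = op_poly_on E p T + op_poly_on E q T"
  unfolding op_poly_on_atMost[OF degree_add_le_max] op_poly_on_atMost[OF max.cobounded1[of "degree p" "degree q"]]
    op_poly_on_atMost[OF max.cobounded2[of "degree q" "degree p"]]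
  by (simp add: sum.distrib scaleR_add_left)

lemma op_poly_on_smult: "op_poly_on E (smult a p) T = a *\<^sub>R op_poly_on E p T"
  unfolding op_poly_on_atMost[OF degree_smult_le] op_poly_on_def by (simp add: scaleR_sum_right)

lemma op_poly_on_commute:
  fixes E T R :: "'a::chilbert_space \<Rightarrow>\<^sub>L 'a"
  assumes "\<And>x. T (R x) = R (T x)" "\<And>x. E (R x) = R (E x)"
  shows "op_poly_on E p T (R x) = R (op_poly_on E p T x)"
  by (induction p) (simp_all add: op_poly_on_pCons blinfun.bilinear_simps assms)

text \<open>Complex coefficients are needed because factoring by the fundamental theorem of algebra
  produces nonreal linear factors. Evaluation on vectors suffices, since only lower bounds of norms
  are extracted.\<close>

definition cpoly_apply :: "complex poly \<Rightarrow> ('a::complex_inner \<Rightarrow>\<^sub>L 'a) \<Rightarrow> 'a \<Rightarrow> 'a" where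
  "cpoly_apply p T x = (\<Sum>i\<le>degree p. coeff p i *\<^sub>C (blinfun_apply T ^^ i) x)"

lemma cpoly_apply_atMost:
  assumes "degree p \<le> n"
  shows "cpoly_apply p T x = (\<Sum>i\<le>n. coeff p i *\<^sub>C (blinfun_apply T ^^ i) x)"
  unfolding cpoly_apply_def
  by (rule sum.mono_neutral_left) (use assms in \<open>auto simp: coeff_eq_0\<close>)

lemma cpoly_apply_zero [simp]: "cpoly_apply 0 T x = 0"
  by (simp add: cpoly_apply_def)

lemma scaleC_sum_right: "c *\<^sub>C sum f A = (\<Sum>i\<in>A. c *\<^sub>C (f i::'a::complex_inner))"
  by (induction A rule: infinite_finite_induct) (simp_all add: scaleC_add_right)

lemma cpoly_apply_pCons:
  assumes "complex_homogeneous T"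
  shows "cpoly_apply (pCons a p) T x = a *\<^sub>C x + T (cpoly_apply p T x)"
  unfolding cpoly_apply_atMost[OF degree_pCons_le] cpoly_apply_def
  by (simp add: sum.atMost_Suc_shift blinfun.sum_right complex_homogeneousD[OF assms] del: sum.atMost_Suc)

lemma cpoly_apply_add: "cpoly_apply (p + q) T x = cpoly_apply p T x + cpoly_apply q T x"
  unfolding cpoly_apply_atMost[OF degree_add_le_max] cpoly_apply_atMost[OF max.cobounded1[of "degree p" "degree q"]]
    cpoly_apply_atMost[OF max.cobounded2[of "degree q" "degree p"]]
  by (simp add: sum.distrib scaleC_add_left)

lemma cpoly_apply_smult: "cpoly_apply (smult a p) T x = a *\<^sub>C cpoly_apply p T x"
  unfolding cpoly_apply_atMost[OF degree_smult_le] cpoly_apply_def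
  by (simp add: scaleC_sum_right scaleC_scaleC)

lemma cpoly_apply_mult:
  assumes "complex_homogeneous T"
  shows "cpoly_apply (p * q) T x = cpoly_apply p T (cpoly_apply q T x)"
  by (induction p)
    (simp_all add: cpoly_apply_pCons[OF assms] cpoly_apply_add cpoly_apply_smult)

text \<open>The constant term acts as the identity in \<open>cpoly_apply\<close> but as
  \<open>E\<close> in \<open>op_poly_on\<close>, so the comparison is made on vectors fixed by
  \<open>E\<close>.\<close>

lemma cpoly_apply_of_real:
  fixes E T :: "'a::chilbert_space \<Rightarrow>\<^sub>L 'a"
  assumes "complex_homogeneous T" "E x = x"
  shows "cpoly_apply (map_poly complex_of_real p) T x = op_poly_on E p T x"
  by (induction p)
    (simp_all add: map_poly_pCons cpoly_apply_pCons[OF assms(1)] op_poly_on_pCons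
      blinfun.bilinear_simps assms(2) scaleC_of_real)

lemma poly_map_poly_of_real: "poly (map_poly complex_of_real p) (of_real t) = of_real (poly p t)"
  by (induction p) (simp_all add: map_poly_pCons)

section \<open>Approximate point spectrum\<close>

definition approx_spectrum :: "('a::chilbert_space \<Rightarrow>\<^sub>L 'a) \<Rightarrow> ('a \<Rightarrow>\<^sub>L 'a) \<Rightarrow> real set" where
  "approx_spectrum E T = {t. \<forall>e>0. \<exists>x. E x = x \<and> norm x = 1 \<and> norm (T x - t *\<^sub>R x) < e}"

text \<open>The second argument is a bare function so that it can be \<open>cpoly_apply q T\<close>
  as well as a shifted operator.\<close>

definition bounded_below_on :: "('a::real_normed_vector \<Rightarrow>\<^sub>L 'a) \<Rightarrow> ('a \<Rightarrow> 'a) \<Rightarrow> bool" where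
  "bounded_below_on E f \<longleftrightarrow> (\<exists>c>0. \<forall>x. E x = x \<longrightarrow> c * norm x \<le> norm (f x))"

lemma not_approx_spectrumD:
  fixes E T :: "'a::chilbert_space \<Rightarrow>\<^sub>L 'a"
  assumes "t \<notin> approx_spectrum E T"
  shows "bounded_below_on E (\<lambda>x. T x - t *\<^sub>R x)"
proof -
  obtain e where e: "e > 0" "\<And>x. E x = x \<Longrightarrow> norm x = 1 \<Longrightarrow> e \<le> norm (T x - t *\<^sub>R x)"
    using assms unfolding approx_spectrum_def by force
  have "e * norm x \<le> norm (T x - t *\<^sub>R x)" if "E x = x" for x
  proof (cases "x = 0")
    case False
    define y where "y = (1 / norm x) *\<^sub>R x"
    have "e \<le> norm (T y - t *\<^sub>R y)"
      by (rule e(2)) (use False that in \<open>simp_all add: y_def blinfun.scaleR_right\<close>)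
    also have "T y - t *\<^sub>R y = (1 / norm x) *\<^sub>R (T x - t *\<^sub>R x)"
      by (simp add: y_def blinfun.scaleR_right scaleR_diff_right)
    also have "norm \<dots> = norm (T x - t *\<^sub>R x) / norm x" by simp
    finally show ?thesis using False by (simp add: pos_le_divide_eq)
  qed simp
  then show ?thesis unfolding bounded_below_on_def using e(1) by blast
qed

lemma approx_spectrum_norm_le:
  fixes E T :: "'a::chilbert_space \<Rightarrow>\<^sub>L 'a"
  assumes "t \<in> approx_spectrum E T"
  shows "\<bar>t\<bar> \<le> norm T"
proof (rule field_le_epsilon)
  fix e :: real assume "0 < e"
  then obtain x where x: "norm x = 1" "norm (T x - t *\<^sub>R x) < e"
    using assms unfolding approx_spectrum_def by blast
  have "\<bar>t\<bar> = norm (T x - (T x - t *\<^sub>R x))" using x(1) by simp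
  also have "\<dots> \<le> norm (T x) + norm (T x - t *\<^sub>R x)" by (rule norm_triangle_ineq4)
  also have "\<dots> \<le> norm T + e" using norm_blinfun[of T x] x by simp
  finally show "\<bar>t\<bar> \<le> norm T + e" .
qed

text \<open>For the adjoint \<open>S\<close> of \<open>T\<close>, almost maximising vectors of \<open>T\<close> are almost eigenvectors of \<open>S T\<close>.\<close>

lemma norm_square_approx_eigenvalue:
  fixes E T S :: "'a::real_inner \<Rightarrow>\<^sub>L 'a"
  assumes adj: "\<And>x y. inner (S x) y = inner x (T y)"
    and TE: "\<And>x. T (E x) = T x" and EE: "\<And>x. E (E x) = E x" and E1: "\<And>x. norm (E x) \<le> norm x"
    and nz: "\<exists>x. E x \<noteq> 0"
  shows "\<not> bounded_below_on E (\<lambda>x. S (T x) - (norm T)\<^sup>2 *\<^sub>R x)"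
proof
  define m where "m = norm T"
  have m0: "0 \<le> m" by (simp add: m_def)
  have nS: "norm S \<le> m" unfolding m_def by (rule norm_adjoint_le) (rule adj)
  assume "bounded_below_on E (\<lambda>x. S (T x) - (norm T)\<^sup>2 *\<^sub>R x)"
  then obtain c where c: "c > 0" "\<And>x. E x = x \<Longrightarrow> c * norm x \<le> norm (S (T x) - m\<^sup>2 *\<^sub>R x)"
    unfolding bounded_below_on_def m_def by blast
  \<comment> \<open>Expanding the square and using \<open>norm (S (T x)) <= m * norm (T x)\<close>,
    the lower bound \<open>c\<close> forces \<open>norm (T x)\<close> to stay away from
    \<open>m * norm x\<close>.\<close>
  have key: "c\<^sup>2 * (norm x)\<^sup>2 \<le> m\<^sup>2 * (m\<^sup>2 * (norm x)\<^sup>2 - (norm (T x))\<^sup>2)" if "E x = x" for x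
  proof -
    have "inner (S (T x)) x = inner (T x) (T x)" by (rule adj)
    moreover from this have "inner x (S (T x)) = inner (T x) (T x)" by (simp only: inner_commute)
    ultimately have expand: "(norm (S (T x) - m\<^sup>2 *\<^sub>R x))\<^sup>2
        = (norm (S (T x)))\<^sup>2 - 2 * m\<^sup>2 * (norm (T x))\<^sup>2 + m\<^sup>2 * m\<^sup>2 * (norm x)\<^sup>2"
      unfolding power2_norm_eq_inner by (simp add: inner_diff_left inner_diff_right algebra_simps)
    have "(c * norm x)\<^sup>2 \<le> (norm (S (T x) - m\<^sup>2 *\<^sub>R x))\<^sup>2"
      by (rule power_mono[OF c(2)[OF that]]) (use c(1) in simp)
    also note expand
    also have "(norm (S (T x)))\<^sup>2 \<le> (m * norm (T x))\<^sup>2"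
      by (intro power_mono order_trans[OF norm_blinfun mult_right_mono[OF nS norm_ge_zero]] norm_ge_zero)
    finally show ?thesis by (simp add: power_mult_distrib algebra_simps)
  qed
  obtain y where y: "E y \<noteq> 0" using nz by blast
  have mpos: "0 < m"
  proof (rule ccontr)
    assume "\<not> 0 < m"
    then have "m = 0" using m0 by simp
    then show False using key[of "E y"] c(1) y by (simp add: EE mult_le_0_iff)
  qed
  \<comment> \<open>\<open>key\<close> solved for \<open>norm (T x) ^ 2\<close>. The result
    \<open>norm T <= sqrt k\<close> contradicts \<open>k < m ^ 2\<close>.\<close>
  define k where "k = m\<^sup>2 - c\<^sup>2 / m\<^sup>2"
  have bound: "(norm (T x))\<^sup>2 \<le> k * (norm x)\<^sup>2" if "E x = x" for x
    using key[OF that] mpos by (simp add: k_def field_simps)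
  have "0 \<le> k * (norm (E y))\<^sup>2" using bound[of "E y"] by (simp add: EE order_trans[OF zero_le_power2])
  then have k0: "0 \<le> k" using y by (simp add: zero_le_mult_iff)
  have "norm (T x) \<le> sqrt k * norm x" for x
  proof -
    have "(norm (T x))\<^sup>2 \<le> k * (norm (E x))\<^sup>2" using bound[of "E x"] by (simp add: EE TE)
    also have "\<dots> \<le> k * (norm x)\<^sup>2" using k0 E1 by (intro mult_left_mono power_mono) auto
    also have "\<dots> = (sqrt k * norm x)\<^sup>2" using k0 by (simp add: power_mult_distrib)
    finally show ?thesis by (rule power2_le_imp_le) (simp add: k0)
  qed
  then have "m \<le> sqrt k" unfolding m_def by (intro norm_blinfun_bound) (use k0 in auto)
  then have "m\<^sup>2 \<le> k" using k0 m0 by (metis real_sqrt_pow2 power_mono)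
  moreover have "0 < c\<^sup>2 / m\<^sup>2" using c(1) mpos by simp
  ultimately show False unfolding k_def by linarith
qed

lemma symmetric_op_compose:
  fixes S T :: "'a::real_inner \<Rightarrow>\<^sub>L 'a"
  assumes "symmetric_op S" "symmetric_op T" "\<And>x. S (T x) = T (S x)"
  shows "symmetric_op (S o\<^sub>L T)"
  using assms by (simp add: symmetric_op_def)

lemma norm_orth_projection_le:
  fixes P :: "'a::chilbert_space \<Rightarrow>\<^sub>L 'a"
  assumes "P \<in> orth_projections"
  shows "norm (P x) \<le> norm x"
proof (cases "P x = 0")
  case False
  have "norm (P x) * norm (P x) = inner x (P x)"
    using assms by (simp add: orth_projections_iff symmetric_op_def power2_norm_eq_inner power2_eq_square[symmetric])
  also have "\<dots> \<le> norm x * norm (P x)" by (rule norm_cauchy_schwarz)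
  finally show ?thesis using False by simp
qed simp

lemma subspace_ops_iff:
  fixes E F T :: "'a::chilbert_space \<Rightarrow>\<^sub>L 'a"
  assumes "E \<in> orth_projections" "F \<in> orth_projections"
  shows "T \<in> subspace_ops E F \<longleftrightarrow> complex_homogeneous T \<and> (\<forall>x. T (E x) = T x) \<and> (\<forall>x. F (T x) = T x)"
proof -
  have "F o\<^sub>L T o\<^sub>L E = T \<longleftrightarrow> (\<forall>x. F (T (E x)) = T x)"
    by (metis blinfun_eqI blinfun_apply_blinfun_compose)
  also have "\<dots> \<longleftrightarrow> (\<forall>x. T (E x) = T x) \<and> (\<forall>x. F (T x) = T x)"
    using assms unfolding orth_projections_iff by metis
  finally show ?thesis by (simp add: subspace_ops_def)
qed

section \<open>Functional calculus for self-adjoint operators\<close>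

text \<open>Unlike \<open>fun_calc_on\<close>, convergence is asked only on the approximate point
  spectrum, where the polynomial norm bound lives; \<open>fun_calc_on_eqI\<close> connects the two.
  A relation instead of a function lets operators be built up by rules.\<close>

definition has_calculus ::
  "('a::chilbert_space \<Rightarrow>\<^sub>L 'a) \<Rightarrow> ('a \<Rightarrow>\<^sub>L 'a) \<Rightarrow> (real \<Rightarrow> real) \<Rightarrow> ('a \<Rightarrow>\<^sub>L 'a) \<Rightarrow> bool" where
  "has_calculus E T f B \<longleftrightarrow> (\<exists>p.
     uniform_limit (approx_spectrum E T) (\<lambda>n. poly (p n)) f sequentially \<and>
     (\<lambda>n. op_poly_on E (p n) T) \<longlonglongrightarrow> B)"

lemma tendsto_blinfun_compose:
  assumes "(f \<longlongrightarrow> a) F" "(g \<longlongrightarrow> b) F"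
  shows "((\<lambda>n. f n o\<^sub>L g n) \<longlongrightarrow> a o\<^sub>L b) F"
  by (rule bounded_bilinear.tendsto[OF bounded_bilinear_blinfun_compose assms])

lemma tendsto_blinfun_apply:
  assumes "(f \<longlongrightarrow> a) F"
  shows "((\<lambda>n. blinfun_apply (f n) x) \<longlongrightarrow> a x) F"
  by (rule blinfun.tendsto[OF assms tendsto_const])

text \<open>Used with unit \<open>id_blinfun\<close> for the square of \<open>P - Q\<close>, and
  with unit \<open>P\<close> for the operator angle.\<close>

locale selfadjoint_operator =
  fixes E T :: "'a::chilbert_space \<Rightarrow>\<^sub>L 'a"
  assumes E: "E \<in> orth_projections" and T: "T \<in> subspace_ops E E" and T_sym: "symmetric_op T"
begin

lemma E_idem [simp]: "E (E x) = E x" and E_sym: "symmetric_op E" and E_hom: "complex_homogeneous E"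
  using E by (simp_all add: orth_projections_iff)

lemma T_E [simp]: "T (E x) = T x" and E_T [simp]: "E (T x) = T x" and T_hom: "complex_homogeneous T"
  using T by (simp_all add: subspace_ops_iff[OF E E])

lemma E_scaleC: "E x = x \<Longrightarrow> E (c *\<^sub>C x) = c *\<^sub>C x"
  by (simp add: complex_homogeneousD[OF E_hom])

lemma E_poly [simp]: "E (op_poly_on E p T x) = op_poly_on E p T x"
  by (induction p) (simp_all add: op_poly_on_pCons blinfun.bilinear_simps)

lemma poly_E [simp]: "op_poly_on E p T (E x) = op_poly_on E p T x"
  using op_poly_on_commute[of T E E p x] by simp

lemma poly_T: "op_poly_on E p T (T x) = T (op_poly_on E p T x)"
  by (rule op_poly_on_commute) simp_all

lemma poly_sym: "symmetric_op (op_poly_on E p T)"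
proof (induction p)
  case (pCons a p)
  have "symmetric_op (T o\<^sub>L op_poly_on E p T)"
    by (rule symmetric_op_compose) (simp_all add: T_sym pCons.IH poly_T)
  then show ?case using E_sym
    by (simp add: op_poly_on_pCons symmetric_op_def blinfun.bilinear_simps inner_add)
qed (simp add: symmetric_op_def)

lemma poly_hom: "complex_homogeneous (op_poly_on E p T)"
  by (induction p)
    (use E_hom T_hom in \<open>simp_all add: op_poly_on_pCons complex_homogeneous_def blinfun.bilinear_simps
      scaleC_add_right scaleC_scaleR\<close>)

lemma op_poly_on_mult: "op_poly_on E (p * q) T = op_poly_on E p T o\<^sub>L op_poly_on E q T"
  by (induction p; rule blinfun_eqI)
    (simp_all add: op_poly_on_pCons op_poly_on_add op_poly_on_smult blinfun.bilinear_simps)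

lemma E_cpoly: "E x = x \<Longrightarrow> E (cpoly_apply p T x) = cpoly_apply p T x"
  by (induction p) (simp_all add: cpoly_apply_pCons[OF T_hom] blinfun.bilinear_simps E_scaleC)

text \<open>For real \<open>z\<close> this is the meaning of not being in the approximate point
  spectrum. For nonreal \<open>z\<close>, symmetry of \<open>T\<close> makes
  \<open>T x - Re z *\<^sub>R x\<close> orthogonal to \<open>\<i> *\<^sub>C x\<close>, so Pythagoras
  gives the lower bound \<open>\<bar>Im z\<bar>\<close>.\<close>

lemma bounded_below_on_linear_factor:
  assumes "\<And>t. t \<in> approx_spectrum E T \<Longrightarrow> z \<noteq> of_real t"
  shows "bounded_below_on E (\<lambda>x. T x - z *\<^sub>C x)"
proof (cases "Im z = 0")
  case True
  then have z: "z = of_real (Re z)" by (simp add: complex_eq_iff)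
  then have "Re z \<notin> approx_spectrum E T" using assms by blast
  then have "bounded_below_on E (\<lambda>x. T x - Re z *\<^sub>R x)" by (rule not_approx_spectrumD)
  then show ?thesis by (subst z) (simp only: scaleC_of_real)
next
  case False
  have "\<bar>Im z\<bar> * norm x \<le> norm (T x - z *\<^sub>C x)" for x
  proof -
    define y where "y = T x - Re z *\<^sub>R x"
    have skew: "inner v (\<i> *\<^sub>C w) = - inner (\<i> *\<^sub>C v) w" for v w :: 'a
      by (simp add: inner_scaleC_left scaleC_minus_left)
    have "inner x (\<i> *\<^sub>C x) = 0" using skew[of x x] by (simp add: inner_commute)
    moreover have "inner (T x) (\<i> *\<^sub>C x) = 0"
      using skew[of "T x" x] T_sym symmetric_opD[OF T_sym, of x "\<i> *\<^sub>C x"]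
      by (simp add: inner_commute complex_homogeneousD[OF T_hom])
    ultimately have orth: "inner y (Im z *\<^sub>R (\<i> *\<^sub>C x)) = 0"
      by (simp add: y_def inner_diff_left)
    have "T x - z *\<^sub>C x = y - Im z *\<^sub>R (\<i> *\<^sub>C x)"
      using scaleC_add_left[of "of_real (Re z)" "of_real (Im z) * \<i>" x]
      by (simp add: y_def scaleC_of_real scaleC_scaleC[symmetric] complex_eq[of z, symmetric] mult.commute scaleC_scaleR)
    then have "(norm (T x - z *\<^sub>C x))\<^sup>2 = (norm y)\<^sup>2 + (norm (Im z *\<^sub>R (\<i> *\<^sub>C x)))\<^sup>2"
      using orth unfolding power2_norm_eq_inner by (simp add: inner_diff inner_commute)
    then have "(\<bar>Im z\<bar> * norm x)\<^sup>2 \<le> (norm (T x - z *\<^sub>C x))\<^sup>2"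
      by (simp add: norm_scaleC)
    then show ?thesis by (rule power2_le_imp_le) simp
  qed
  then show ?thesis unfolding bounded_below_on_def using False by (intro exI[of _ "\<bar>Im z\<bar>"]) auto
qed

text \<open>Induction on the degree: split off a complex root and multiply the lower bounds of the
  factors.\<close>

lemma bounded_below_on_cpoly:
  assumes "q \<noteq> 0" "\<And>t. t \<in> approx_spectrum E T \<Longrightarrow> poly q (of_real t) \<noteq> 0"
  shows "bounded_below_on E (cpoly_apply q T)"
  using assms
proof (induction "degree q" arbitrary: q)
  case 0
  then obtain a where a: "q = [:a:]" using degree_eq_zeroE by metis
  then have "a \<noteq> 0" using 0 by auto
  then show ?case unfolding bounded_below_on_def a
    by (intro exI[of _ "cmod a"]) (simp add: cpoly_apply_pCons[OF T_hom] norm_scaleC)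
next
  case (Suc n)
  then have "\<not> (\<exists>a l. a \<noteq> 0 \<and> l = 0 \<and> q = pCons a l)" by auto
  then obtain z where z: "poly q z = 0" using fundamental_theorem_of_algebra_alt by blast
  then obtain r where r: "q = [:-z, 1:] * r" by (auto simp: poly_eq_0_iff_dvd)
  have "r \<noteq> 0" using Suc.prems r by auto
  then have "degree q = degree [:-z, 1:] + degree r" unfolding r by (intro degree_mult_eq) auto
  then have "n = degree r" using Suc.hyps by simp
  then have "bounded_below_on E (cpoly_apply r T)"
    using Suc.prems(2) \<open>r \<noteq> 0\<close> by (intro Suc.hyps(1)) (auto simp: r)
  then obtain c where c: "c > 0" "\<And>x. E x = x \<Longrightarrow> c * norm x \<le> norm (cpoly_apply r T x)"
    unfolding bounded_below_on_def by blast
  have "bounded_below_on E (\<lambda>x. T x - z *\<^sub>C x)"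
    using Suc.prems(2) z by (intro bounded_below_on_linear_factor) auto
  then obtain d where d: "d > 0" "\<And>x. E x = x \<Longrightarrow> d * norm x \<le> norm (T x - z *\<^sub>C x)"
    unfolding bounded_below_on_def by blast
  have "d * c * norm x \<le> norm (cpoly_apply q T x)" if x: "E x = x" for x
  proof -
    let ?y = "cpoly_apply r T x"
    have "d * c * norm x \<le> d * norm ?y" using c(2)[OF x] d(1) by simp
    also have "\<dots> \<le> norm (T ?y - z *\<^sub>C ?y)" by (rule d(2)) (rule E_cpoly[OF x])
    also have "T ?y - z *\<^sub>C ?y = cpoly_apply q T x"
      unfolding r cpoly_apply_mult[OF T_hom] by (simp add: cpoly_apply_pCons[OF T_hom] scaleC_minus_left)
    finally show ?thesis .
  qed
  then show ?case unfolding bounded_below_on_def using c(1) d(1) by (intro exI[of _ "d * c"]) auto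
qed

text \<open>Since \<open>p(T)\<close> is its own adjoint,
  \<open>norm_square_approx_eigenvalue\<close> says that \<open>q(T)\<close> is not bounded below;
  by \<open>bounded_below_on_cpoly\<close> this requires a zero of \<open>q\<close> in the
  approximate point spectrum.\<close>

lemma poly_norm_square_approx_eigenvalue:
  assumes "\<exists>x. E x \<noteq> 0" "q \<noteq> 0" "q = p * p - [:(norm (op_poly_on E p T))\<^sup>2:]"
  shows "\<exists>t\<in>approx_spectrum E T. poly q t = 0"
proof (rule ccontr)
  assume none: "\<not> ?thesis"
  let ?A = "op_poly_on E p T"
  have "map_poly complex_of_real q \<noteq> 0" using assms(2) by (simp add: map_poly_eq_0_iff)
  then have "bounded_below_on E (cpoly_apply (map_poly complex_of_real q) T)"
    by (rule bounded_below_on_cpoly) (use none in \<open>auto simp: poly_map_poly_of_real\<close>)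
  moreover have "cpoly_apply (map_poly complex_of_real q) T x = ?A (?A x) - (norm ?A)\<^sup>2 *\<^sub>R x" if "E x = x" for x
  proof -
    have q: "q = p * p + [:- (norm ?A)\<^sup>2:]" using assms(3) by simp
    show ?thesis unfolding cpoly_apply_of_real[OF T_hom that] unfolding q op_poly_on_add op_poly_on_mult
      by (simp add: op_poly_on_pCons blinfun.bilinear_simps that)
  qed
  ultimately have "bounded_below_on E (\<lambda>x. ?A (?A x) - (norm ?A)\<^sup>2 *\<^sub>R x)"
    unfolding bounded_below_on_def by auto
  then show False
    using norm_square_approx_eigenvalue[of ?A ?A E] assms(1) norm_orth_projection_le[OF E] symmetric_opD[OF poly_sym]
    by auto
qed

text \<open>For the polynomial \<open>[:0, 1:]\<close> the difference \<open>q\<close> is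
  \<open>t ^ 2\<close> minus a constant, hence never the zero polynomial.\<close>

lemma approx_spectrum_nonempty:
  assumes "\<exists>x. E x \<noteq> 0"
  shows "approx_spectrum E T \<noteq> {}"
  using poly_norm_square_approx_eigenvalue[OF assms _ refl, of "[:0, 1:]"] by auto

text \<open>The estimate behind the continuous calculus: polynomials that are uniformly close on the
  approximate point spectrum give operators close in norm.\<close>

lemma norm_op_poly_on_le:
  assumes "\<And>t. t \<in> approx_spectrum E T \<Longrightarrow> \<bar>poly p t\<bar> \<le> M" "0 \<le> M"
  shows "norm (op_poly_on E p T) \<le> M"
proof (cases "\<exists>x. E x \<noteq> 0")
  case False
  then have "op_poly_on E p T x = 0" for x using E_poly by metis
  then have "op_poly_on E p T = 0" by (intro blinfun_eqI) simp
  then show ?thesis using assms(2) by simp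
next
  case True
  define q where "q = p * p - [:(norm (op_poly_on E p T))\<^sup>2:]"
  \<comment> \<open>If \<open>q\<close> vanishes identically, every point of the nonempty
    approximate point spectrum will do.\<close>
  obtain t where t: "t \<in> approx_spectrum E T" "poly q t = 0"
    using poly_norm_square_approx_eigenvalue[OF True _ q_def] approx_spectrum_nonempty[OF True] by (cases "q = 0") auto
  then have "(norm (op_poly_on E p T))\<^sup>2 = \<bar>poly p t\<bar>\<^sup>2" by (simp add: q_def power2_eq_square)
  then have "norm (op_poly_on E p T) = \<bar>poly p t\<bar>" by (rule power2_eq_imp_eq) simp_all
  then show ?thesis using assms(1)[OF t(1)] by simp
qed

end

section \<open>Weierstrass approximation and the rules of the continuous functional calculus\<close>

lemma weierstrass_poly:
  fixes f :: "real \<Rightarrow> real"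
  assumes "continuous_on {a..b} f"
  obtains p :: "nat \<Rightarrow> real poly" where "uniform_limit {a..b} (\<lambda>n. poly (p n)) f sequentially"
proof -
  have "\<exists>q. \<forall>x\<in>{a..b}. \<bar>f x - poly q x\<bar> < 1 / Suc n" for n
  proof -
    obtain g where g: "real_polynomial_function g" "\<And>x. x \<in> {a..b} \<Longrightarrow> \<bar>f x - g x\<bar> < 1 / Suc n"
      by (rule Stone_Weierstrass_real_polynomial_function[OF _ assms, of "1 / Suc n"]) auto
    obtain c m where "g = (\<lambda>x. \<Sum>i\<le>m. c i * x ^ i)"
      using g(1) unfolding real_polynomial_function_iff_sum by blast
    then have "g = poly (\<Sum>i\<le>m. monom (c i) i)" by (auto simp: poly_sum poly_monom)
    then show ?thesis using g(2) by blast
  qed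
  then obtain p where p: "\<And>n x. x \<in> {a..b} \<Longrightarrow> \<bar>f x - poly (p n) x\<bar> < 1 / Suc n" by metis
  have "uniform_limit {a..b} (\<lambda>n. poly (p n)) f sequentially"
  proof (rule uniform_limitI)
    fix e :: real assume "0 < e"
    then have "\<forall>\<^sub>F n in sequentially. 1 / real (Suc n) < e"
      by (intro order_tendstoD(2)[OF LIMSEQ_Suc[OF lim_1_over_n]])
    then show "\<forall>\<^sub>F n in sequentially. \<forall>x\<in>{a..b}. dist (poly (p n) x) (f x) < e"
    proof eventually_elim
      case (elim n)
      then show ?case using p[of _ n] by (force simp: dist_real_def abs_minus_commute)
    qed
  qed
  then show thesis by (rule that)
qed

context selfadjoint_operator
begin

lemma approx_spectrum_subset: "approx_spectrum E T \<subseteq> {- norm T..norm T}"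
  using approx_spectrum_norm_le abs_le_iff by fastforce

lemma calculus_norm_le:
  assumes "has_calculus E T f B" "\<And>t. t \<in> approx_spectrum E T \<Longrightarrow> \<bar>f t\<bar> \<le> M" "0 \<le> M"
  shows "norm B \<le> M"
proof (rule field_le_epsilon)
  fix e :: real assume "0 < e"
  obtain p where p: "uniform_limit (approx_spectrum E T) (\<lambda>n. poly (p n)) f sequentially"
    "(\<lambda>n. op_poly_on E (p n) T) \<longlonglongrightarrow> B" using assms(1) unfolding has_calculus_def by blast
  have "\<forall>\<^sub>F n in sequentially. \<forall>t\<in>approx_spectrum E T. dist (poly (p n) t) (f t) < e"
    using p(1) \<open>0 < e\<close> by (rule uniform_limitD)
  then have "\<forall>\<^sub>F n in sequentially. norm (op_poly_on E (p n) T) \<le> M + e"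
  proof eventually_elim
    case (elim n)
    have "\<bar>poly (p n) t\<bar> \<le> M + e" if "t \<in> approx_spectrum E T" for t
      using elim[rule_format, OF that] assms(2)[OF that] by (simp add: dist_real_def)
    then show ?case using assms(3) \<open>0 < e\<close> by (intro norm_op_poly_on_le) auto
  qed
  then show "norm B \<le> M + e"
    by (rule tendsto_upperbound[OF tendsto_norm[OF p(2)]]) simp
qed

lemma calculus_cong:
  assumes "has_calculus E T f B" "\<And>t. t \<in> approx_spectrum E T \<Longrightarrow> f t = g t"
  shows "has_calculus E T g B"
proof -
  have "uniform_limit (approx_spectrum E T) p f sequentially = uniform_limit (approx_spectrum E T) p g sequentially" for p
    by (rule uniform_limit_cong') (use assms(2) in auto)
  then show ?thesis using assms(1) unfolding has_calculus_def by simp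
qed

lemma calculus_poly: "has_calculus E T (poly p) (op_poly_on E p T)"
  unfolding has_calculus_def by (intro exI[of _ "\<lambda>_. p"]) (auto intro: uniform_limit_const)

lemma calculus_const: "has_calculus E T (\<lambda>_. c) (c *\<^sub>R E)"
proof -
  have "op_poly_on E [:c:] T = c *\<^sub>R E"
    by (simp add: op_poly_on_pCons bounded_bilinear.zero_right[OF bounded_bilinear_blinfun_compose])
  then show ?thesis using calculus_cong[OF calculus_poly[of "[:c:]"], of "\<lambda>_. c"] by simp
qed

lemma calculus_id: "has_calculus E T (\<lambda>t. t) T"
proof -
  have "op_poly_on E [:0, 1:] T = T"
    by (rule blinfun_eqI) (simp add: op_poly_on_pCons blinfun.bilinear_simps)
  then show ?thesis using calculus_cong[OF calculus_poly[of "[:0, 1:]"], of "\<lambda>t. t"] by simp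
qed

lemma calculus_add:
  assumes "has_calculus E T f A" "has_calculus E T g B"
  shows "has_calculus E T (\<lambda>t. f t + g t) (A + B)"
proof -
  obtain p q where p: "uniform_limit (approx_spectrum E T) (\<lambda>n. poly (p n)) f sequentially"
    "(\<lambda>n. op_poly_on E (p n) T) \<longlonglongrightarrow> A"
    and q: "uniform_limit (approx_spectrum E T) (\<lambda>n. poly (q n)) g sequentially"
    "(\<lambda>n. op_poly_on E (q n) T) \<longlonglongrightarrow> B" using assms unfolding has_calculus_def by blast
  have "uniform_limit (approx_spectrum E T) (\<lambda>n. poly (p n + q n)) (\<lambda>t. f t + g t) sequentially"
    using uniform_limit_add[OF p(1) q(1)] by (simp add: fun_eq_iff[THEN iffD2, OF allI, OF poly_add])
  moreover have "(\<lambda>n. op_poly_on E (p n + q n) T) \<longlonglongrightarrow> A + B"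
    using tendsto_add[OF p(2) q(2)] by (simp add: op_poly_on_add)
  ultimately show ?thesis unfolding has_calculus_def by (intro exI[of _ "\<lambda>n. p n + q n"] conjI)
qed

text \<open>Products of uniform limits converge uniformly only under boundedness; here it comes from
  one polynomial within distance 1 of \<open>f\<close>, bounded on a compact interval.\<close>

lemma calculus_bounded:
  assumes "has_calculus E T f B"
  shows "bounded (f ` approx_spectrum E T)"
proof -
  obtain p where p: "uniform_limit (approx_spectrum E T) (\<lambda>n. poly (p n)) f sequentially"
    using assms unfolding has_calculus_def by blast
  have "\<forall>\<^sub>F n in sequentially. \<forall>t\<in>approx_spectrum E T. dist (poly (p n) t) (f t) < 1"
    by (rule uniform_limitD[OF p]) simp
  then obtain n where n: "\<forall>t\<in>approx_spectrum E T. dist (poly (p n) t) (f t) < 1"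
    using eventually_happens' sequentially_bot by blast
  have "bounded (poly (p n) ` {- norm T..norm T})"
    by (intro compact_imp_bounded compact_continuous_image continuous_intros) simp
  then obtain M where M: "\<And>t. t \<in> {- norm T..norm T} \<Longrightarrow> \<bar>poly (p n) t\<bar> \<le> M"
    unfolding bounded_iff by (metis image_eqI real_norm_def)
  have "\<bar>f t\<bar> \<le> M + 1" if "t \<in> approx_spectrum E T" for t
  proof -
    have "\<bar>poly (p n) t\<bar> \<le> M" using M that approx_spectrum_subset by blast
    then show ?thesis using n[rule_format, OF that] by (simp add: dist_real_def)
  qed
  then show ?thesis unfolding bounded_iff by auto
qed

lemma calculus_mult:
  assumes "has_calculus E T f A" "has_calculus E T g B"
  shows "has_calculus E T (\<lambda>t. f t * g t) (A o\<^sub>L B)"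
proof -
  obtain p q where p: "uniform_limit (approx_spectrum E T) (\<lambda>n. poly (p n)) f sequentially"
    "(\<lambda>n. op_poly_on E (p n) T) \<longlonglongrightarrow> A"
    and q: "uniform_limit (approx_spectrum E T) (\<lambda>n. poly (q n)) g sequentially"
    "(\<lambda>n. op_poly_on E (q n) T) \<longlonglongrightarrow> B" using assms unfolding has_calculus_def by blast
  have "uniform_limit (approx_spectrum E T) (\<lambda>n. poly (p n * q n)) (\<lambda>t. f t * g t) sequentially"
    using uniform_lim_mult[OF p(1) q(1) calculus_bounded[OF assms(1)] calculus_bounded[OF assms(2)]]
    by (simp add: fun_eq_iff[THEN iffD2, OF allI, OF poly_mult])
  moreover have "(\<lambda>n. op_poly_on E (p n * q n) T) \<longlonglongrightarrow> (A o\<^sub>L B)"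
    using tendsto_blinfun_compose[OF p(2) q(2)] by (simp add: op_poly_on_mult)
  ultimately show ?thesis unfolding has_calculus_def by (intro exI[of _ "\<lambda>n. p n * q n"] conjI)
qed

lemma calculus_E:
  assumes "has_calculus E T f B"
  shows "B (E x) = B x" "E (B x) = B x"
proof -
  obtain p where p: "(\<lambda>n. op_poly_on E (p n) T) \<longlonglongrightarrow> B" using assms unfolding has_calculus_def by blast
  note lim = tendsto_blinfun_apply[OF p]
  show "B (E x) = B x" by (rule LIMSEQ_unique[OF lim]) (use lim[of x] in simp)
  show "E (B x) = B x"
    using blinfun.tendsto[OF tendsto_const[of E] lim[of x]] lim[of x] by (auto intro: LIMSEQ_unique)
qed

lemma calculus_scaleR:
  assumes "has_calculus E T f B"
  shows "has_calculus E T (\<lambda>t. c * f t) (c *\<^sub>R B)"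
proof -
  have "c *\<^sub>R E o\<^sub>L B = c *\<^sub>R B"
    by (rule blinfun_eqI) (simp add: blinfun.bilinear_simps calculus_E[OF assms])
  then show ?thesis using calculus_mult[OF calculus_const[of c] assms] by simp
qed

lemma calculus_diff:
  assumes "has_calculus E T f A" "has_calculus E T g B"
  shows "has_calculus E T (\<lambda>t. f t - g t) (A - B)"
  using calculus_add[OF assms(1) calculus_scaleR[OF assms(2), of "-1"]] by simp

text \<open>The difference belongs to a function vanishing on the approximate point spectrum, so its
  norm is at most 0. Later operator identities are derived from scalar ones in this way.\<close>

lemma calculus_unique:
  assumes "has_calculus E T f A" "has_calculus E T g B" "\<And>t. t \<in> approx_spectrum E T \<Longrightarrow> f t = g t"
  shows "A = B"
  using calculus_norm_le[OF calculus_diff[OF assms(1,2)], of 0] assms(3) by simp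

lemma calculus_hom:
  assumes "has_calculus E T f B"
  shows "complex_homogeneous B"
proof -
  obtain p where p: "(\<lambda>n. op_poly_on E (p n) T) \<longlonglongrightarrow> B" using assms unfolding has_calculus_def by blast
  note lim = tendsto_blinfun_apply[OF p]
  have "B (c *\<^sub>C x) = c *\<^sub>C B x" for c x
    by (rule LIMSEQ_unique[OF lim])
      (use bounded_linear.tendsto[OF bounded_linear_scaleC lim] in \<open>simp add: complex_homogeneousD[OF poly_hom]\<close>)
  then show ?thesis by (simp add: complex_homogeneous_def)
qed

lemma calculus_sym:
  assumes "has_calculus E T f B"
  shows "symmetric_op B"
proof -
  obtain p where p: "(\<lambda>n. op_poly_on E (p n) T) \<longlonglongrightarrow> B" using assms unfolding has_calculus_def by blast
  note lim = tendsto_blinfun_apply[OF p]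
  have "inner (B x) y = inner x (B y)" for x y
  proof (rule LIMSEQ_unique)
    show "(\<lambda>n. inner (op_poly_on E (p n) T x) y) \<longlonglongrightarrow> inner (B x) y" by (intro tendsto_intros lim)
    show "(\<lambda>n. inner (op_poly_on E (p n) T x) y) \<longlonglongrightarrow> inner x (B y)"
      unfolding symmetric_opD[OF poly_sym] by (intro tendsto_intros lim)
  qed
  then show ?thesis by (simp add: symmetric_op_def)
qed

lemma calculus_commute:
  fixes R :: "'a \<Rightarrow>\<^sub>L 'a"
  assumes "has_calculus E T f B" "\<And>x. T (R x) = blinfun_apply R (T x)" "\<And>x. E (R x) = R (E x)"
  shows "B (R x) = R (B x)"
proof -
  obtain p where p: "(\<lambda>n. op_poly_on E (p n) T) \<longlonglongrightarrow> B" using assms unfolding has_calculus_def by blast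
  note lim = tendsto_blinfun_apply[OF p]
  show ?thesis
    by (rule LIMSEQ_unique[OF lim])
      (use blinfun.tendsto[OF tendsto_const[of R] lim] in \<open>simp add: op_poly_on_commute[of T R E, OF assms(2,3)]\<close>)
qed

text \<open>Allows the calculus to be iterated, as in the arctangent of a square root.\<close>

lemma calculus_operator:
  assumes "has_calculus E T f B"
  shows "selfadjoint_operator E B"
  by unfold_locales
    (use E calculus_sym[OF assms] calculus_hom[OF assms] calculus_E[OF assms] in \<open>auto simp: subspace_ops_iff[OF E E]\<close>)

lemma calculus_of_uniform_limit:
  assumes "uniform_limit (approx_spectrum E T) (\<lambda>n. poly (p n)) f sequentially"
  obtains B where "has_calculus E T f B" "(\<lambda>n. op_poly_on E (p n) T) \<longlonglongrightarrow> B"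
proof -
  have "Cauchy (\<lambda>n. op_poly_on E (p n) T)"
  proof (rule metric_CauchyI)
    fix e :: real assume e: "0 < e"
    have "\<forall>\<^sub>F n in sequentially. \<forall>t\<in>approx_spectrum E T. dist (poly (p n) t) (f t) < e / 4"
      by (rule uniform_limitD[OF assms]) (use e in simp)
    then obtain N where N: "\<And>n t. n \<ge> N \<Longrightarrow> t \<in> approx_spectrum E T \<Longrightarrow> dist (poly (p n) t) (f t) < e / 4"
      unfolding eventually_sequentially by blast
    have "dist (op_poly_on E (p m) T) (op_poly_on E (p n) T) < e" if "m \<ge> N" "n \<ge> N" for m n
    proof -
      have "op_poly_on E (p m) T - op_poly_on E (p n) T = op_poly_on E (p m + smult (-1) (p n)) T"
        by (simp only: op_poly_on_add op_poly_on_smult) simp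
      also have "norm \<dots> \<le> e / 2"
      proof (rule norm_op_poly_on_le)
        show "\<bar>poly (p m + smult (- 1) (p n)) t\<bar> \<le> e / 2" if t: "t \<in> approx_spectrum E T" for t
          using N[OF \<open>m \<ge> N\<close> t] N[OF \<open>n \<ge> N\<close> t] unfolding dist_real_def poly_add poly_smult by argo
      qed (use e in simp)
      finally show ?thesis using e by (simp add: dist_norm)
    qed
    then show "\<exists>M. \<forall>m\<ge>M. \<forall>n\<ge>M. dist (op_poly_on E (p m) T) (op_poly_on E (p n) T) < e" by blast
  qed
  then obtain B where "(\<lambda>n. op_poly_on E (p n) T) \<longlonglongrightarrow> B" using Cauchy_convergent convergent_def by blast
  then show thesis using that assms unfolding has_calculus_def by blast
qed

lemma calculus_exists:
  assumes "continuous_on {a..b} f" "approx_spectrum E T \<subseteq> {a..b}"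
  shows "\<exists>B. has_calculus E T f B"
proof -
  obtain p where "uniform_limit {a..b} (\<lambda>n. poly (p n)) f sequentially"
    using weierstrass_poly[OF assms(1)] by blast
  then show ?thesis using calculus_of_uniform_limit[OF uniform_limit_on_subset[OF _ assms(2)]] by metis
qed

text \<open>A bounded inverse cannot send arbitrarily short vectors
  \<open>T x - t *\<^sub>R x\<close> to unit vectors.\<close>

lemma approx_spectrum_subset_spectrum_on:
  assumes "t \<in> approx_spectrum E T"
  shows "complex_of_real t \<in> spectrum_on E T"
proof (rule ccontr)
  assume "\<not> ?thesis"
  then obtain S where S: "S \<in> subspace_ops E E" "\<And>x. x \<in> range E \<Longrightarrow> S (T x - t *\<^sub>R x) = x"
    unfolding spectrum_on_def mem_Collect_eq not_not scaleC_of_real by blast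
  \<comment> \<open>Chosen so that \<open>norm S * e < 1\<close>; the summand 1 also covers
    \<open>norm S = 0\<close>.\<close>
  define e where "e = 1 / (norm S + 1)"
  have e: "0 < e" by (simp add: e_def add_nonneg_pos)
  then obtain x where x: "E x = x" "norm x = 1" "norm (T x - t *\<^sub>R x) < e"
    using assms unfolding approx_spectrum_def by blast
  have "1 = norm (S (T x - t *\<^sub>R x))" using S(2)[of x] x(1,2) by (metis rangeI)
  also have "\<dots> \<le> norm S * norm (T x - t *\<^sub>R x)" by (rule norm_blinfun)
  also have "\<dots> \<le> norm S * e" using x(3) by (intro mult_left_mono) auto
  also have "\<dots> < 1" by (simp add: e_def pos_divide_less_eq add_nonneg_pos)
  finally show False by simp
qed

text \<open>Outside \<open>{- norm T..norm T}\<close> the resolvent is the function \<open>1 / (x - t)\<close> of \<open>T\<close>.\<close>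

lemma real_spectrum_on_subset:
  assumes "complex_of_real t \<in> spectrum_on E T"
  shows "t \<in> {- norm T..norm T}"
proof (rule ccontr)
  assume t: "t \<notin> {- norm T..norm T}"
  have "continuous_on {- norm T..norm T} (\<lambda>x. 1 / (x - t))"
    using t by (intro continuous_intros) auto
  then obtain S where S: "has_calculus E T (\<lambda>x. 1 / (x - t)) S"
    using calculus_exists[OF _ approx_spectrum_subset] by blast
  have D: "has_calculus E T (\<lambda>x. x - t) (T - t *\<^sub>R E)" by (rule calculus_diff[OF calculus_id calculus_const])
  have "S o\<^sub>L (T - t *\<^sub>R E) = 1 *\<^sub>R E"
    by (rule calculus_unique[OF calculus_mult[OF S D] calculus_const]) (use t approx_spectrum_subset in auto)
  then have left: "S (T x - t *\<^sub>R E x) = E x" for x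
    by (metis blinfun_apply_blinfun_compose blinfun.diff_left blinfun.scaleR_left scaleR_one)
  have "(T - t *\<^sub>R E) o\<^sub>L S = 1 *\<^sub>R E"
    by (rule calculus_unique[OF calculus_mult[OF D S] calculus_const]) (use t approx_spectrum_subset in auto)
  then have right: "T (S x) - t *\<^sub>R S x = E x" for x
    using calculus_E[OF S] by (metis blinfun_apply_blinfun_compose blinfun.diff_left blinfun.scaleR_left scaleR_one)
  have "S \<in> subspace_ops E E" using calculus_operator[OF S] by (rule selfadjoint_operator.T)
  then have "complex_of_real t \<notin> spectrum_on E T"
    unfolding spectrum_on_def using left right by (fastforce simp: scaleC_of_real blinfun.bilinear_simps)
  then show False using assms by simp
qed

text \<open>The real spectrum lies between the approximate point spectrum and
  \<open>{- norm T..norm T}\<close>. Approximation on the larger interval gives existence,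
  restriction to the smaller set gives uniqueness.\<close>

lemma fun_calc_on_eqI:
  assumes "continuous_on {- norm T..norm T} f" "has_calculus E T f B"
  shows "fun_calc_on E f T = B"
  unfolding fun_calc_on_def
proof (rule the_equality)
  let ?S = "{t. complex_of_real t \<in> spectrum_on E T}"
  obtain p where p: "uniform_limit {- norm T..norm T} (\<lambda>n. poly (p n)) f sequentially"
    using weierstrass_poly[OF assms(1)] by blast
  obtain C where C: "has_calculus E T f C" "(\<lambda>n. op_poly_on E (p n) T) \<longlonglongrightarrow> C"
    using calculus_of_uniform_limit[OF uniform_limit_on_subset[OF p approx_spectrum_subset]] by blast
  have "C = B" by (rule calculus_unique[OF C(1) assms(2)]) simp
  moreover have "uniform_limit ?S (\<lambda>n. poly (p n)) f sequentially"
    by (rule uniform_limit_on_subset[OF p]) (use real_spectrum_on_subset in blast)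
  ultimately show "\<exists>p. uniform_limit ?S (\<lambda>n. poly (p n)) f sequentially \<and> (\<lambda>n. op_poly_on E (p n) T) \<longlonglongrightarrow> B"
    using C(2) by blast
next
  fix B' assume B': "\<exists>p. uniform_limit {t. complex_of_real t \<in> spectrum_on E T} (\<lambda>n. poly (p n)) f sequentially
    \<and> (\<lambda>n. op_poly_on E (p n) T) \<longlonglongrightarrow> B'"
  have "approx_spectrum E T \<subseteq> {t. complex_of_real t \<in> spectrum_on E T}"
    using approx_spectrum_subset_spectrum_on by blast
  then have "has_calculus E T f B'"
    unfolding has_calculus_def using B' uniform_limit_on_subset by blast
  then show "B' = B" by (rule calculus_unique[OF _ assms(2)]) simp
qed

lemma approx_spectrum_poly:
  assumes "t \<in> approx_spectrum E T"
  shows "poly p t \<in> approx_spectrum E (op_poly_on E p T)"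
  unfolding approx_spectrum_def
proof safe
  fix e :: real assume e: "0 < e"
  have "poly (p - [:poly p t:]) t = 0" by simp
  \<comment> \<open>Dividing \<open>p - p(t)\<close> by the linear factor shows that
    \<open>p(T) x - p(t) x\<close> is the bounded operator \<open>q(T)\<close> applied to the short
    vector \<open>T x - t x\<close>.\<close>
  then obtain q where q: "p - [:poly p t:] = [:-t, 1:] * q" unfolding poly_eq_0_iff_dvd by (auto elim: dvdE)
  then have p: "p = q * [:-t, 1:] + [:poly p t:]" by (simp add: algebra_simps)
  let ?q = "op_poly_on E q T"
  have pos: "0 < norm ?q + 1" by (simp add: add_nonneg_pos)
  then have "0 < e / (norm ?q + 1)" using e by simp
  then obtain x where x: "E x = x" "norm x = 1" "norm (T x - t *\<^sub>R x) < e / (norm ?q + 1)"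
    using assms unfolding approx_spectrum_def by blast
  have "op_poly_on E p T x = op_poly_on E (q * [:-t, 1:] + [:poly p t:]) T x" using p by metis
  also have "\<dots> = ?q (T x - t *\<^sub>R x) + poly p t *\<^sub>R x"
    unfolding op_poly_on_add op_poly_on_mult
    by (simp add: op_poly_on_pCons blinfun.bilinear_simps x(1))
  finally have "norm (op_poly_on E p T x - poly p t *\<^sub>R x) = norm (?q (T x - t *\<^sub>R x))" by simp
  also have "\<dots> \<le> norm ?q * norm (T x - t *\<^sub>R x)" by (rule norm_blinfun)
  also have "\<dots> \<le> (norm ?q + 1) * norm (T x - t *\<^sub>R x)" by (intro mult_right_mono) auto
  also have "\<dots> < e" using x(3) pos by (simp add: pos_less_divide_eq mult.commute)
  finally show "\<exists>x. E x = x \<and> norm x = 1 \<and> norm (op_poly_on E p T x - poly p t *\<^sub>R x) < e"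
    using x(1,2) by blast
qed

text \<open>One inclusion of the spectral mapping theorem, by approximating \<open>f\<close> with a
  polynomial within \<open>e / 3\<close>. It supplies the lower bound for the norm of the operator
  angle.\<close>

lemma approx_spectrum_calculus:
  assumes "has_calculus E T f B" "t \<in> approx_spectrum E T"
  shows "f t \<in> approx_spectrum E B"
  unfolding approx_spectrum_def
proof safe
  fix e :: real assume "0 < e"
  then have e3: "0 < e / 3" by simp
  obtain p where p: "uniform_limit (approx_spectrum E T) (\<lambda>n. poly (p n)) f sequentially"
    "(\<lambda>n. op_poly_on E (p n) T) \<longlonglongrightarrow> B" using assms(1) unfolding has_calculus_def by blast
  have "\<forall>\<^sub>F n in sequentially. dist (poly (p n) t) (f t) < e / 3 \<and> dist (op_poly_on E (p n) T) B < e / 3"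
  proof (rule eventually_conj)
    have "\<forall>\<^sub>F n in sequentially. \<forall>s\<in>approx_spectrum E T. dist (poly (p n) s) (f s) < e / 3"
      by (rule uniform_limitD[OF p(1) e3])
    then show "\<forall>\<^sub>F n in sequentially. dist (poly (p n) t) (f t) < e / 3"
      by eventually_elim (use assms(2) in blast)
    show "\<forall>\<^sub>F n in sequentially. dist (op_poly_on E (p n) T) B < e / 3"
      by (rule tendstoD[OF p(2) e3])
  qed
  then obtain n where n: "dist (poly (p n) t) (f t) < e / 3" "dist (op_poly_on E (p n) T) B < e / 3"
    using eventually_happens' sequentially_bot by blast
  let ?A = "op_poly_on E (p n) T"
  obtain x where x: "E x = x" "norm x = 1" "norm (?A x - poly (p n) t *\<^sub>R x) < e / 3"
    using approx_spectrum_poly[OF assms(2), of "p n"] e3 unfolding approx_spectrum_def by blast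
  have "B x - f t *\<^sub>R x = (B - ?A) x + (?A x - poly (p n) t *\<^sub>R x) + (poly (p n) t - f t) *\<^sub>R x"
    by (simp add: blinfun.diff_left algebra_simps)
  also have "norm \<dots> \<le> norm ((B - ?A) x) + norm (?A x - poly (p n) t *\<^sub>R x) + norm ((poly (p n) t - f t) *\<^sub>R x)"
    by (intro norm_triangle_le add_right_mono norm_triangle_ineq)
  also have "\<dots> < e / 3 + e / 3 + e / 3"
  proof (intro add_strict_mono x(3))
    have "norm ((B - ?A) x) \<le> norm (B - ?A)" using norm_blinfun[of "B - ?A" x] x(2) by simp
    then show "norm ((B - ?A) x) < e / 3" using n(2) by (simp add: dist_norm norm_minus_commute)
    show "norm ((poly (p n) t - f t) *\<^sub>R x) < e / 3" using n(1) x(2) by (simp add: dist_real_def)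
  qed
  finally show "\<exists>x. E x = x \<and> norm x = 1 \<and> norm (B x - f t *\<^sub>R x) < e" using x(1,2) by auto
qed

end

section \<open>The angle between orthogonal projections\<close>

lemma orth_projectionD:
  fixes P :: "'a::chilbert_space \<Rightarrow>\<^sub>L 'a"
  assumes "P \<in> orth_projections"
  shows "P (P x) = P x" "inner (P x) y = inner x (P y)" "complex_homogeneous P" "symmetric_op P"
  using assms by (auto simp: orth_projections_iff symmetric_op_def)

lemma orth_projection_pythagoras:
  fixes P :: "'a::chilbert_space \<Rightarrow>\<^sub>L 'a"
  assumes "P \<in> orth_projections"
  shows "(norm (P x))\<^sup>2 + (norm (x - P x))\<^sup>2 = (norm x)\<^sup>2"
proof -
  have "inner (P x) x = inner (P x) (P x)" "inner x (P x) = inner (P x) (P x)"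
    using orth_projectionD(1,2)[OF assms] by metis+
  then show ?thesis unfolding power2_norm_eq_inner by (simp add: inner_diff_left inner_diff_right)
qed

text \<open>With \<open>w = x - Q x\<close>, the vector \<open>(P - Q) x\<close> is
  \<open>P w\<close> minus \<open>Q x - P (Q x)\<close>, and these are orthogonal. The first is
  estimated by duality: \<open>inner (P w) (P w) = inner w (P w - Q (P w))\<close> because
  \<open>Q w = 0\<close>. The two bounds then add up by Pythagoras for \<open>Q\<close>.\<close>

lemma norm_orth_projection_diff_le:
  fixes P Q :: "'a::chilbert_space \<Rightarrow>\<^sub>L 'a"
  assumes P: "P \<in> orth_projections" and Q: "Q \<in> orth_projections" and s: "0 \<le> s"
    and PQ: "\<And>x. norm (Q x - P (Q x)) \<le> s * norm (Q x)"
    and QP: "\<And>x. norm (P x - Q (P x)) \<le> s * norm (P x)"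
  shows "norm (P - Q) \<le> s"
proof (rule norm_blinfun_bound[OF s])
  fix x
  define w where "w = x - Q x"
  define u where "u = Q x - P (Q x)"
  define v where "v = P w"
  have Pu: "P u = 0" by (simp add: u_def blinfun.diff_right orth_projectionD(1)[OF P])
  have Qw: "Q w = 0" by (simp add: w_def blinfun.diff_right orth_projectionD(1)[OF Q])
  have "inner v u = 0" unfolding v_def by (simp add: orth_projectionD(2)[OF P] Pu)
  then have ortho: "inner v u = 0" "inner u v = 0" by (simp_all add: inner_commute)
  have split: "(P - Q) x = v - u"
    by (simp add: u_def v_def w_def blinfun.bilinear_simps)
  have "(norm ((P - Q) x))\<^sup>2 = (norm v)\<^sup>2 + (norm u)\<^sup>2"
    unfolding split power2_norm_eq_inner using ortho by (simp add: inner_diff_left inner_diff_right)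
  also have "\<dots> \<le> (s * norm w)\<^sup>2 + (s * norm (Q x))\<^sup>2"
  proof (rule add_mono)
    show "(norm u)\<^sup>2 \<le> (s * norm (Q x))\<^sup>2" using PQ[of x] unfolding u_def by (rule power_mono) simp
    have "norm v \<le> s * norm w"
    proof (cases "norm v = 0")
      case False
      have "norm v * norm v = inner w v"
        unfolding v_def using orth_projectionD(1,2)[OF P, of w] by (simp add: power2_norm_eq_inner[symmetric] power2_eq_square[symmetric])
           (simp add: power2_norm_eq_inner orth_projectionD[OF P])
      also have "\<dots> = inner w (v - Q v)"
        using orth_projectionD(2)[OF Q, of w v] Qw by (simp add: inner_diff_right)
      also have "\<dots> \<le> norm w * norm (v - Q v)" by (rule norm_cauchy_schwarz)
      also have "\<dots> \<le> norm w * (s * norm v)" using QP[of w] unfolding v_def by (intro mult_left_mono) auto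
      finally have "norm v * norm v \<le> (s * norm w) * norm v" by (simp add: mult.commute mult.left_commute)
      then show ?thesis by (rule mult_right_le_imp_le) (use False in simp)
    qed (use s in simp)
    then show "(norm v)\<^sup>2 \<le> (s * norm w)\<^sup>2" by (rule power_mono) simp
  qed
  also have "\<dots> = (s * norm x)\<^sup>2"
    using orth_projection_pythagoras[OF Q, of x] unfolding w_def power_mult_distrib by (simp add: distrib_left[symmetric] add.commute)
  finally show "norm ((P - Q) x) \<le> s * norm x" by (rule power2_le_imp_le) (simp add: s)
qed

lemma norm_orth_projection_diff_le_1:
  fixes P Q :: "'a::chilbert_space \<Rightarrow>\<^sub>L 'a"
  assumes P: "P \<in> orth_projections" and Q: "Q \<in> orth_projections"
  shows "norm (P - Q) \<le> 1"
proof (rule norm_orth_projection_diff_le[OF P Q])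
  have le: "norm (x - R x) \<le> norm x" if "R \<in> orth_projections" for R :: "'a \<Rightarrow>\<^sub>L 'a" and x
  proof (rule power2_le_imp_le)
    show "(norm (x - R x))\<^sup>2 \<le> (norm x)\<^sup>2"
      using orth_projection_pythagoras[OF that, of x] zero_le_power2[of "norm (R x)"] by linarith
  qed simp
  show "norm (Q x - P (Q x)) \<le> 1 * norm (Q x)" "norm (P x - Q (P x)) \<le> 1 * norm (P x)" for x
    using le P Q by simp_all
qed simp

text \<open>The cosine is estimated from below: \<open>norm (P x)\<close> is at least
  \<open>norm (P (Q x)) - norm (P (x - Q x))\<close>, and the two terms give the addition formula
  for \<open>cos (a + b)\<close>.\<close>

lemma angle_to_projection_le:
  fixes P Q R :: "'a::chilbert_space \<Rightarrow>\<^sub>L 'a"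
  assumes P: "P \<in> orth_projections" and Q: "Q \<in> orth_projections" and R: "R \<in> orth_projections"
    and ab: "0 \<le> a" "0 \<le> b" "a + b \<le> pi / 2"
    and a: "norm (P - Q) \<le> sin a" and b: "norm (Q - R) \<le> sin b" and x: "R x = x"
  shows "norm (x - P x) \<le> sin (a + b) * norm x"
proof -
  have pos: "0 \<le> sin a" "0 \<le> cos a" "0 \<le> sin b" "0 \<le> cos b" "0 \<le> cos (a + b)" "0 \<le> sin (a + b)"
    using ab by (auto intro!: sin_ge_zero cos_ge_zero)
  define n s c where "n = norm x" and "s = norm (x - Q x)" and "c = norm (Q x)"
  have nn: "0 \<le> n" "0 \<le> s" "0 \<le> c" by (simp_all add: n_def s_def c_def)
  have cs: "c\<^sup>2 + s\<^sup>2 = n\<^sup>2" unfolding c_def s_def n_def by (rule orth_projection_pythagoras[OF Q])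
  have "s = norm ((Q - R) x)" by (simp add: s_def blinfun.diff_left x norm_minus_commute)
  also have "\<dots> \<le> sin b * n" unfolding n_def
    by (rule order_trans[OF norm_blinfun mult_right_mono[OF b norm_ge_zero]])
  finally have s_le: "s \<le> sin b * n" .
  have "(cos b * n)\<^sup>2 \<le> c\<^sup>2"
    using cs power_mono[OF s_le nn(2), of 2] by (simp add: power_mult_distrib cos_squared_eq algebra_simps)
  then have c_ge: "cos b * n \<le> c" by (rule power2_le_imp_le) (rule nn)
  have "norm (Q x - P (Q x)) = norm ((P - Q) (Q x))"
    by (simp add: blinfun.diff_left orth_projectionD(1)[OF Q] norm_minus_commute)
  also have "\<dots> \<le> sin a * c" unfolding c_def
    by (rule order_trans[OF norm_blinfun mult_right_mono[OF a norm_ge_zero]])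
  finally have 1: "norm (Q x - P (Q x)) \<le> sin a * c" .
  have "(cos a * c)\<^sup>2 \<le> (norm (P (Q x)))\<^sup>2"
    using orth_projection_pythagoras[OF P, of "Q x"] power_mono[OF 1 norm_ge_zero, of 2]
    by (simp add: power_mult_distrib cos_squared_eq algebra_simps c_def)
  then have 2: "cos a * c \<le> norm (P (Q x))" by (rule power2_le_imp_le) simp
  \<comment> \<open>\<open>Q\<close> annihilates \<open>x - Q x\<close>, so \<open>P\<close> acts on
    it as \<open>P - Q\<close>.\<close>
  have "norm (P (x - Q x)) = norm ((P - Q) (x - Q x))"
    by (simp add: blinfun.diff_left blinfun.diff_right orth_projectionD(1)[OF Q])
  also have "\<dots> \<le> sin a * s" unfolding s_def
    by (rule order_trans[OF norm_blinfun mult_right_mono[OF a norm_ge_zero]])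
  finally have 3: "norm (P (x - Q x)) \<le> sin a * s" .
  have "cos (a + b) * n = cos a * (cos b * n) - sin a * (sin b * n)"
    by (simp add: cos_add algebra_simps)
  also have "\<dots> \<le> cos a * c - sin a * s"
    using mult_left_mono[OF c_ge pos(2)] mult_left_mono[OF s_le pos(1)] by linarith
  also have "\<dots> \<le> norm (P (Q x)) - norm (P (x - Q x))" using 2 3 by linarith
  also have "\<dots> \<le> norm (P (Q x) + P (x - Q x))" by (rule norm_diff_ineq)
  also have "P (Q x) + P (x - Q x) = P x" by (simp add: blinfun.add_right[symmetric])
  \<comment> \<open>Squaring is allowed because \<open>a + b <= pi / 2\<close> keeps the cosine
    nonnegative.\<close>
  finally have "(cos (a + b) * n)\<^sup>2 \<le> (norm (P x))\<^sup>2"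
    by (rule power_mono) (use pos nn in simp)
  then have "(norm (x - P x))\<^sup>2 \<le> (sin (a + b) * n)\<^sup>2"
    using orth_projection_pythagoras[OF P, of x]
    by (simp add: power_mult_distrib sin_squared_eq algebra_simps n_def)
  then show ?thesis unfolding n_def by (rule power2_le_imp_le) (use pos in simp)
qed

definition proj_angle :: "('a::chilbert_space \<Rightarrow>\<^sub>L 'a) \<Rightarrow> ('a \<Rightarrow>\<^sub>L 'a) \<Rightarrow> real" where
  "proj_angle P Q = arcsin (norm (P - Q))"

lemma proj_angle_commute: "proj_angle P Q = proj_angle Q P"
  by (simp add: proj_angle_def norm_minus_commute)

context
  fixes P Q :: "'a::chilbert_space \<Rightarrow>\<^sub>L 'a"
  assumes PQ: "P \<in> orth_projections" "Q \<in> orth_projections"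
begin

lemma proj_angle_bounds: "0 \<le> proj_angle P Q" "proj_angle P Q \<le> pi / 2"
  using norm_orth_projection_diff_le_1[OF PQ] arcsin_le_arcsin[of 0 "norm (P - Q)"]
    arcsin_ubound[of "norm (P - Q)"] norm_ge_zero[of "P - Q"]
  unfolding proj_angle_def by (simp_all del: norm_ge_zero)

lemma sin_proj_angle: "sin (proj_angle P Q) = norm (P - Q)"
  using norm_orth_projection_diff_le_1[OF PQ] norm_ge_zero[of "P - Q"] unfolding proj_angle_def
  by (intro sin_arcsin) linarith+

lemma proj_angle_leI:
  assumes "norm (P - Q) \<le> sin a" "0 \<le> a"
  shows "proj_angle P Q \<le> a"
proof (cases "a \<le> pi / 2")
  case True
  have "proj_angle P Q \<le> arcsin (sin a)" unfolding proj_angle_def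
    by (rule arcsin_le_arcsin) (use assms norm_ge_zero[of "P - Q"] in \<open>simp_all del: norm_ge_zero\<close>)
  then show ?thesis using True assms(2) by (simp add: arcsin_sin)
qed (use proj_angle_bounds in simp)

end

text \<open>Trivial if the angles add up to more than \<open>pi / 2\<close>. Otherwise
  \<open>angle_to_projection_le\<close>, read from \<open>R\<close> to \<open>P\<close> and from
  \<open>P\<close> to \<open>R\<close>, supplies both one-sided bounds for the difference.\<close>

lemma proj_angle_triangle:
  fixes P Q R :: "'a::chilbert_space \<Rightarrow>\<^sub>L 'a"
  assumes P: "P \<in> orth_projections" and Q: "Q \<in> orth_projections" and R: "R \<in> orth_projections"
  shows "proj_angle P R \<le> proj_angle P Q + proj_angle Q R"
proof (cases "proj_angle P Q + proj_angle Q R \<le> pi / 2")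
  case True
  let ?a = "proj_angle P Q" and ?b = "proj_angle Q R"
  have ab: "0 \<le> ?a" "0 \<le> ?b" using proj_angle_bounds P Q R by auto
  have s: "norm (P - Q) \<le> sin ?a" "norm (Q - R) \<le> sin ?b" using sin_proj_angle[OF P Q] sin_proj_angle[OF Q R] by simp_all
  show ?thesis
  proof (rule proj_angle_leI[OF P R])
    show "norm (P - R) \<le> sin (?a + ?b)"
    proof (rule norm_orth_projection_diff_le[OF P R])
      show "0 \<le> sin (?a + ?b)" using ab True by (intro sin_ge_zero) auto
      show "norm (R x - P (R x)) \<le> sin (?a + ?b) * norm (R x)" for x
        by (rule angle_to_projection_le[OF P Q R ab True s]) (rule orth_projectionD(1)[OF R])
      have "norm (P x - R (P x)) \<le> sin (?b + ?a) * norm (P x)" for x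
        by (rule angle_to_projection_le[OF R Q P ab(2,1)])
          (use True s orth_projectionD(1)[OF P] in \<open>simp_all add: norm_minus_commute add.commute\<close>)
      then show "norm (P x - R (P x)) \<le> sin (?a + ?b) * norm (P x)" for x by (simp add: add.commute)
    qed
  qed (use ab in simp)
next
  case False
  then show ?thesis using proj_angle_bounds(2)[OF P R] by linarith
qed

lemma proj_angle_le_sum:
  assumes "\<And>j. j \<le> n \<Longrightarrow> f j \<in> orth_projections"
  shows "proj_angle (f 0) (f n) \<le> (\<Sum>j<n. proj_angle (f j) (f (Suc j)))"
  using assms
proof (induction n)
  case (Suc n)
  have "proj_angle (f 0) (f (Suc n)) \<le> proj_angle (f 0) (f n) + proj_angle (f n) (f (Suc n))"
    using Suc.prems by (intro proj_angle_triangle) auto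
  then show ?case using Suc by fastforce
qed (simp add: proj_angle_def)

section \<open>Lengths of paths of projections\<close>

text \<open>A quantitative form of \<open>arcsin u \<sim> u\<close>: with
  \<open>\<phi> = arcsin u\<close> the bound on \<open>u\<close> means
  \<open>z <= cos \<phi>\<close>, and \<open>\<phi> <= tan \<phi>\<close> gives
  \<open>z * \<phi> <= sin \<phi>\<close>.\<close>

lemma arcsin_mult_le:
  assumes "0 \<le> u" "u \<le> sqrt (1 - z\<^sup>2)" "0 < z" "z < 1"
  shows "z * arcsin u \<le> u"
proof -
  have "u\<^sup>2 \<le> 1 - z\<^sup>2" proof -
    have "z\<^sup>2 \<le> 1" using assms by (simp add: power_le_one)
    then have "(sqrt (1 - z\<^sup>2))\<^sup>2 = 1 - z\<^sup>2" by simp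
    then show ?thesis using power_mono[OF assms(2,1), of 2] by simp
  qed
  then have z: "z\<^sup>2 \<le> 1 - u\<^sup>2" by simp
  have z0: "0 < z\<^sup>2" using assms by simp
  then have u1: "u\<^sup>2 < 1\<^sup>2" using z z0 unfolding power_one by linarith
  then have "u < 1" by (rule power2_less_imp_less) simp
  define \<phi> where "\<phi> = arcsin u"
  have \<phi>: "0 \<le> \<phi>" "\<phi> < pi / 2"
    unfolding \<phi>_def using arcsin_le_arcsin[of 0 u] arcsin_less_arcsin[of u 1] assms(1) \<open>u < 1\<close> by auto
  have sin: "sin \<phi> = u" unfolding \<phi>_def using assms(1) \<open>u < 1\<close> by simp
  have cos: "0 < cos \<phi>" using \<phi> by (intro cos_gt_zero_pi) auto
  have "z\<^sup>2 \<le> (cos \<phi>)\<^sup>2" using z sin by (simp add: cos_squared_eq)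
  then have "z \<le> cos \<phi>" by (rule power2_le_imp_le) (use cos in simp)
  then have "z * \<phi> \<le> cos \<phi> * \<phi>" using \<phi> by (intro mult_right_mono) auto
  moreover have "\<phi> \<le> tan \<phi>"
    using abs_arctan_le[of "tan \<phi>"] arctan_tan[of \<phi>] \<phi> assms(1) cos sin by (simp add: tan_def)
  then have "cos \<phi> * \<phi> \<le> cos \<phi> * tan \<phi>" using cos by (intro mult_left_mono) auto
  moreover have "cos \<phi> * tan \<phi> = u" using cos sin by (simp add: tan_def)
  ultimately show ?thesis by (simp add: \<phi>_def)
qed

lemma proj_angle_le_path_length:
  fixes \<gamma> :: "real \<Rightarrow> ('a::chilbert_space \<Rightarrow>\<^sub>L 'a)"
  assumes "a \<le> b" "continuous_on {a..b} \<gamma>" "\<gamma> ` {a..b} \<subseteq> orth_projections"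
  shows "ennreal (proj_angle (\<gamma> a) (\<gamma> b)) \<le> path_length a b \<gamma>"
\<comment> \<open>Partitions have strictly increasing nodes, so the degenerate interval is split
  off; its angle is 0. For infinite length the bound is trivial.\<close>
proof (cases "a = b \<or> path_length a b \<gamma> = \<infinity>")
  case False
  then have ab: "a < b" using assms(1) by simp
  obtain l where l: "path_length a b \<gamma> = ennreal l" "0 \<le> l" using False by (cases "path_length a b \<gamma>") auto
  have "proj_angle (\<gamma> a) (\<gamma> b) \<le> l"
  proof (rule field_le_mult_one_interval)
    fix z :: real assume z: "0 < z" "z < 1"
    \<comment> \<open>The step size below which \<open>arcsin_mult_le\<close> loses at most the
      factor \<open>z\<close>; uniform continuity makes every step of an equidistant partition that
      small.\<close>
    define \<eta> where "\<eta> = sqrt (1 - z\<^sup>2)"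
    have "z\<^sup>2 < 1" using z by (simp add: power_less_one_iff)
    then have \<eta>: "0 < \<eta>" by (simp add: \<eta>_def)
    have "uniformly_continuous_on {a..b} \<gamma>" by (rule compact_uniformly_continuous[OF assms(2)]) simp
    then obtain d where d: "d > 0" "\<And>s t. s \<in> {a..b} \<Longrightarrow> t \<in> {a..b} \<Longrightarrow> dist s t < d \<Longrightarrow> dist (\<gamma> s) (\<gamma> t) < \<eta>"
      using \<eta> unfolding uniformly_continuous_on_def by metis
    obtain n where n: "(b - a) / d < real n" using reals_Archimedean2 by blast
    then have "0 < real n" using ab d(1) by (meson divide_pos_pos diff_gt_0_iff_gt less_trans)
    then have n0: "0 < n" by simp
    define t where "t j = a + real j * ((b - a) / n)" for j :: nat
    have t_step: "t (Suc j) - t j = (b - a) / n" for j by (simp add: t_def algebra_simps add_divide_distrib diff_divide_distrib)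
    have t_less: "t j < t (Suc j)" for j
    proof -
      have "0 < (b - a) / n" using ab n0 by simp
      then show ?thesis using t_step[of j] by linarith
    qed
    have t_in: "t j \<in> {a..b}" if "j \<le> n" for j
    proof -
      have "real j * ((b - a) / n) \<le> real n * ((b - a) / n)" using that ab by (intro mult_right_mono) auto
      then show ?thesis using ab n0 by (simp add: t_def)
    qed
    have t0: "t 0 = a" and tn: "t n = b" using n0 by (simp_all add: t_def)
    have small: "norm (\<gamma> (t j) - \<gamma> (t (Suc j))) \<le> \<eta>" if "j < n" for j
    proof -
      have "(b - a) / n < d" using n n0 d(1) by (simp add: field_simps)
      then have "dist (t j) (t (Suc j)) < d" using t_step[of j] t_less[of j] by (simp add: dist_real_def)
      then have "dist (\<gamma> (t j)) (\<gamma> (t (Suc j))) < \<eta>" using t_in that by (intro d(2)) auto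
      then show ?thesis by (simp add: dist_norm)
    qed
    have "proj_angle (\<gamma> a) (\<gamma> b) \<le> (\<Sum>j<n. proj_angle (\<gamma> (t j)) (\<gamma> (t (Suc j))))"
      using proj_angle_le_sum[of n "\<gamma> \<circ> t"] t_in assms(3) t0 tn by (auto simp: image_subset_iff)
    then have "z * proj_angle (\<gamma> a) (\<gamma> b) \<le> z * (\<Sum>j<n. proj_angle (\<gamma> (t j)) (\<gamma> (t (Suc j))))"
      using z by simp
    also have "\<dots> = (\<Sum>j<n. z * proj_angle (\<gamma> (t j)) (\<gamma> (t (Suc j))))" by (rule sum_distrib_left)
    also have "\<dots> \<le> (\<Sum>j<n. norm (\<gamma> (t (Suc j)) - \<gamma> (t j)))"
    proof (rule sum_mono)
      fix j assume "j \<in> {..<n}"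
      then have "norm (\<gamma> (t j) - \<gamma> (t (Suc j))) \<le> \<eta>" using small by simp
      then show "z * proj_angle (\<gamma> (t j)) (\<gamma> (t (Suc j))) \<le> norm (\<gamma> (t (Suc j)) - \<gamma> (t j))"
        unfolding proj_angle_def norm_minus_commute[of "\<gamma> (t (Suc j))"] using z
        by (intro arcsin_mult_le) (auto simp: \<eta>_def)
    qed
    also have "\<dots> \<le> l"
    proof -
      have "(\<Sum>j<n. ennreal (norm (\<gamma> (t (Suc j)) - \<gamma> (t j)))) \<le> path_length a b \<gamma>"
        unfolding path_length_def by (rule Sup_upper) (use t0 tn t_less in blast)
      then show ?thesis using l by (simp add: sum_nonneg)
    qed
    finally show "z * proj_angle (\<gamma> a) (\<gamma> b) \<le> l" .
  qed
  then show ?thesis using l by (simp add: ennreal_leI)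
next
  case True
  then show ?thesis by (auto simp: proj_angle_def)
qed

lemma proj_angle_le_length_metric:
  fixes P Q :: "'a::chilbert_space \<Rightarrow>\<^sub>L 'a"
  shows "ennreal (proj_angle P Q) \<le> \<rho> P Q"
  unfolding length_metric_def
  by (rule Inf_greatest) (use proj_angle_le_path_length in blast)

section \<open>Upper bounds from Lipschitz paths\<close>

lemma path_length_lipschitz:
  assumes "0 \<le> L" "\<And>s t. s \<in> {a..b} \<Longrightarrow> t \<in> {a..b} \<Longrightarrow> norm (\<gamma> s - \<gamma> t) \<le> L * \<bar>s - t\<bar>"
  shows "path_length a b \<gamma> \<le> ennreal (L * (b - a))"
  unfolding path_length_def
proof (rule Sup_least, clarify)
  fix n :: nat and t :: "nat \<Rightarrow> real"
  assume t: "\<forall>j<n. t j < t (Suc j)"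
  have mono: "t i \<le> t j" if "i \<le> j" "j \<le> n" for i j
    using that
  proof (induction j)
    case (Suc j)
    show ?case
    proof (cases "i = Suc j")
      case False
      then have "t i \<le> t j" using Suc by simp
      also have "t j < t (Suc j)" using t Suc.prems(2) by simp
      finally show ?thesis by simp
    qed simp
  qed simp
  let ?f = "\<lambda>j. norm (\<gamma> (t (Suc j)) - \<gamma> (t j))"
  assume a: "a = t 0" and b: "b = t n"
  have "sum ?f {..<n} \<le> (\<Sum>j<n. L * (t (Suc j) - t j))"
  proof (rule sum_mono)
    fix j assume "j \<in> {..<n}"
    then have j: "j < n" by simp
    then have "?f j \<le> L * \<bar>t (Suc j) - t j\<bar>"
      using a b mono[of 0 j] mono[of j n] mono[of 0 "Suc j"] mono[of "Suc j" n] by (intro assms(2)) auto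
    then show "?f j \<le> L * (t (Suc j) - t j)" using t j by (simp add: less_imp_le)
  qed
  also have "\<dots> = L * (t n - t 0)" by (simp add: sum_distrib_left[symmetric] sum_lessThan_telescope)
  finally show "(\<Sum>j<n. ennreal (?f j)) \<le> ennreal (L * (t n - t 0))"
    by (simp add: ennreal_leI)
qed

lemma length_metric_lipschitz:
  assumes "a \<le> b" "0 \<le> L" "\<gamma> ` {a..b} \<subseteq> X"
    "\<And>s t. s \<in> {a..b} \<Longrightarrow> t \<in> {a..b} \<Longrightarrow> norm (\<gamma> s - \<gamma> t) \<le> L * \<bar>s - t\<bar>"
  shows "length_metric X (\<gamma> a) (\<gamma> b) \<le> ennreal (L * (b - a))"
proof -
  have len: "path_length a b \<gamma> \<le> ennreal (L * (b - a))" by (rule path_length_lipschitz) (use assms in auto)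
  have "L-lipschitz_on {a..b} \<gamma>"
    by (rule lipschitz_onI) (use assms in \<open>auto simp: dist_norm\<close>)
  then have "continuous_on {a..b} \<gamma>" by (rule lipschitz_on_continuous_on)
  moreover have "path_length a b \<gamma> < \<infinity>" using len by (rule le_less_trans) simp
  ultimately have "length_metric X (\<gamma> a) (\<gamma> b) \<le> path_length a b \<gamma>"
    unfolding length_metric_def using assms(1,3) by (intro Inf_lower) blast
  then show ?thesis using len by (rule order_trans)
qed

section \<open>Closure properties of complex homogeneous and of symmetric operators\<close>

lemma complex_homogeneous_compose:
  fixes S T :: "'a::chilbert_space \<Rightarrow>\<^sub>L 'a"
  assumes "complex_homogeneous S" "complex_homogeneous T"
  shows "complex_homogeneous (S o\<^sub>L T)"
  using assms by (simp add: complex_homogeneous_def)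

lemma complex_homogeneous_add:
  fixes S T :: "'a::chilbert_space \<Rightarrow>\<^sub>L 'a"
  assumes "complex_homogeneous S" "complex_homogeneous T"
  shows "complex_homogeneous (S + T)"
  using assms by (simp add: complex_homogeneous_def blinfun.add_left scaleC_add_right)

lemma complex_homogeneous_diff:
  fixes S T :: "'a::chilbert_space \<Rightarrow>\<^sub>L 'a"
  assumes "complex_homogeneous S" "complex_homogeneous T"
  shows "complex_homogeneous (S - T)"
  using assms by (simp add: complex_homogeneous_def blinfun.diff_left scaleC_diff_right)

lemma complex_homogeneous_scaleR:
  fixes T :: "'a::chilbert_space \<Rightarrow>\<^sub>L 'a"
  assumes "complex_homogeneous T"
  shows "complex_homogeneous (r *\<^sub>R T)"
  using assms by (simp add: complex_homogeneous_def blinfun.scaleR_left scaleC_scaleR)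

lemma complex_homogeneous_id: "complex_homogeneous id_blinfun"
  by (simp add: complex_homogeneous_def)

lemmas complex_homogeneous_intros = complex_homogeneous_compose complex_homogeneous_add
  complex_homogeneous_diff complex_homogeneous_scaleR complex_homogeneous_id

lemma symmetric_op_add: "symmetric_op S \<Longrightarrow> symmetric_op T \<Longrightarrow> symmetric_op (S + T)"
  and symmetric_op_diff: "symmetric_op S \<Longrightarrow> symmetric_op T \<Longrightarrow> symmetric_op (S - T)"
  and symmetric_op_scaleR: "symmetric_op T \<Longrightarrow> symmetric_op (r *\<^sub>R T)"
  and symmetric_op_id: "symmetric_op id_blinfun"
  by (simp_all add: symmetric_op_def blinfun.bilinear_simps inner_add_left inner_add_right
      inner_diff_left inner_diff_right)

lemma id_blinfun_orth_projection: "id_blinfun \<in> orth_projections"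
  by (simp add: orth_projections_iff complex_homogeneous_id symmetric_op_id)

text \<open>The nontrivial half of the C*-identity; it reduces norm bounds for \<open>S A B\<close>
  to its square, which is a function of \<open>C\<close>.\<close>

lemma norm_power2_le_norm_compose:
  fixes S :: "'a::real_inner \<Rightarrow>\<^sub>L 'a"
  assumes "symmetric_op S"
  shows "(norm S)\<^sup>2 \<le> norm (S o\<^sub>L S)"
proof -
  have "norm S \<le> sqrt (norm (S o\<^sub>L S))"
  proof (rule norm_blinfun_bound)
    fix x
    have "(norm (S x))\<^sup>2 = inner x ((S o\<^sub>L S) x)"
      by (simp add: power2_norm_eq_inner symmetric_opD[OF assms])
    also have "\<dots> \<le> norm x * norm ((S o\<^sub>L S) x)" by (rule norm_cauchy_schwarz)
    also have "\<dots> \<le> norm x * (norm (S o\<^sub>L S) * norm x)" by (intro mult_left_mono norm_blinfun) simp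
    also have "\<dots> = (sqrt (norm (S o\<^sub>L S)) * norm x)\<^sup>2"
      by (simp add: power_mult_distrib power2_eq_square[of "norm x"])
    finally show "norm (S x) \<le> sqrt (norm (S o\<^sub>L S)) * norm x" by (rule power2_le_imp_le) simp
  qed simp
  then have "(norm S)\<^sup>2 \<le> (sqrt (norm (S o\<^sub>L S)))\<^sup>2" by (rule power_mono) simp
  then show ?thesis by simp
qed

text \<open>Removes the singularity at 0 from the quotient of sines in the off-diagonal coefficient
  of the geodesic, so that the continuous calculus applies.\<close>

definition sinc :: "real \<Rightarrow> real" where
  "sinc u = (if u = 0 then 1 else sin u / u)"

lemma continuous_on_sinc: "continuous_on A sinc"
proof -
  have "isCont sinc x" for x
  proof (cases "x = 0")
    case True
    have "((\<lambda>h::real. sin h / h) \<longlongrightarrow> 1) (at 0)"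
      using DERIV_sin[of 0] by (simp add: DERIV_def)
    then have "(sinc \<longlongrightarrow> 1) (at 0)"
      by (rule Lim_transform_eventually) (auto simp: sinc_def eventually_at_filter)
    then show ?thesis by (simp add: True isCont_def sinc_def)
  next
    case False
    have "isCont (\<lambda>u. sin u / u) x" using False by (intro continuous_intros) auto
    moreover have "\<forall>\<^sub>F u in nhds x. sinc u = sin u / u"
      using eventually_nhds_in_open[of "- {0}" x] False by (auto elim!: eventually_mono simp: sinc_def)
    ultimately show ?thesis by (simp add: isCont_cong)
  qed
  then show ?thesis by (simp add: continuous_at_imp_continuous_on)
qed

lemma mult_sinc: "u * sinc u = sin u"
  by (simp add: sinc_def)

section \<open>Two projections at distance less than one: the commuting operator \<open>C\<close>
  and the angular operator\<close>

locale projection_pair =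
  fixes P Q :: "'a::chilbert_space \<Rightarrow>\<^sub>L 'a"
  assumes P: "P \<in> orth_projections" and Q: "Q \<in> orth_projections" and less_1: "norm (P - Q) < 1"
begin

definition C :: "'a \<Rightarrow>\<^sub>L 'a" where "C = (P - Q) o\<^sub>L (P - Q)"

lemma P_P [simp]: "P (P x) = P x" and Q_Q [simp]: "Q (Q x) = Q x"
  by (simp_all add: orth_projectionD(1)[OF P] orth_projectionD(1)[OF Q])

lemmas hom = orth_projectionD(3)[OF P] orth_projectionD(3)[OF Q]
lemmas sym = orth_projectionD(4)[OF P] orth_projectionD(4)[OF Q]

lemma C_apply: "C x = P x + Q x - P (Q x) - Q (P x)"
  by (simp add: C_def blinfun.bilinear_simps)

text \<open>Both sides equal \<open>P - P Q P\<close>, respectively \<open>Q - Q P Q\<close>. Hence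
  all functions of \<open>C\<close> commute with \<open>P\<close> and \<open>Q\<close>.\<close>

lemma P_C: "P (C x) = C (P x)" and Q_C: "Q (C x) = C (Q x)"
  by (simp_all add: C_apply blinfun.bilinear_simps)

sublocale C: selfadjoint_operator id_blinfun C
proof
  show "C \<in> subspace_ops id_blinfun id_blinfun"
    unfolding subspace_ops_iff[OF id_blinfun_orth_projection id_blinfun_orth_projection] C_def
    by (auto intro!: complex_homogeneous_intros hom)
  show "symmetric_op C" unfolding C_def
    by (intro symmetric_op_compose symmetric_op_diff sym) simp_all
qed (rule id_blinfun_orth_projection)

abbreviation (input) d :: real where "d \<equiv> norm (P - Q)"

text \<open>\<open>C\<close> is the square of a symmetric operator, so \<open>inner (C x) x\<close>
  is nonnegative, which excludes negative approximate eigenvalues.\<close>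

lemma spectrum_C: "approx_spectrum id_blinfun C \<subseteq> {0..d\<^sup>2}"
proof
  fix t assume t: "t \<in> approx_spectrum id_blinfun C"
  have "norm C \<le> d\<^sup>2" unfolding C_def power2_eq_square by (rule norm_blinfun_compose)
  then have "t \<le> d\<^sup>2" using approx_spectrum_norm_le[OF t] by linarith
  moreover have "0 \<le> t"
  proof (rule ccontr)
    assume "\<not> 0 \<le> t"
    then obtain x where x: "norm x = 1" "norm (C x - t *\<^sub>R x) < - t"
      using t unfolding approx_spectrum_def mem_Collect_eq by (meson neg_0_less_iff_less not_le)
    have "inner (C x) x = (norm ((P - Q) x))\<^sup>2"
      using symmetric_opD[OF symmetric_op_diff[OF sym], of "(P - Q) x" x]
      by (simp add: C_def power2_norm_eq_inner)
    then have "- t \<le> inner (C x - t *\<^sub>R x) x"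
      using x(1) by (simp add: inner_diff_left flip: power2_norm_eq_inner)
    also have "\<dots> \<le> norm (C x - t *\<^sub>R x) * norm x" by (rule norm_cauchy_schwarz)
    finally show False using x by simp
  qed
  ultimately show "t \<in> {0..d\<^sup>2}" by simp
qed

lemma calculus_C_exists:
  assumes "continuous_on {0..d\<^sup>2} f"
  shows "\<exists>B. has_calculus id_blinfun C f B"
  by (rule C.calculus_exists[OF assms spectrum_C])

lemma calculus_C_commute:
  assumes "has_calculus id_blinfun C f B"
  shows "P (B x) = B (P x)" "Q (B x) = B (Q x)" "C (B x) = B (C x)"
  by (rule C.calculus_commute[OF assms, symmetric]; simp add: P_C Q_C)+

lemma d2_less_1: "d\<^sup>2 < 1"
  using less_1 by (simp add: power_less_one_iff)

text \<open>With \<open>R\<close> the inverse of \<open>I - C\<close>, the graph vector over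
  \<open>P x\<close> is \<open>Q (R (P x))\<close>, because \<open>P Q P\<close> is
  \<open>(I - C) P\<close>. Subtracting \<open>P x\<close> leaves the angular operator.\<close>

lemma angular_operator_exists:
  obtains X where "is_angular_operator P Q X"
proof -
  have "continuous_on {0..d\<^sup>2} (\<lambda>x. 1 / (1 - x))"
    using d2_less_1 by (intro continuous_intros) auto
  then obtain R where R: "has_calculus id_blinfun C (\<lambda>x. 1 / (1 - x)) R" using calculus_C_exists by blast
  have D: "has_calculus id_blinfun C (\<lambda>x. 1 - x) (1 *\<^sub>R id_blinfun - C)"
    by (rule C.calculus_diff[OF C.calculus_const C.calculus_id])
  have "R o\<^sub>L (1 *\<^sub>R id_blinfun - C) = 1 *\<^sub>R id_blinfun"
    by (rule C.calculus_unique[OF C.calculus_mult[OF R D] C.calculus_const])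
      (use spectrum_C d2_less_1 in fastforce)
  then have inv: "R x - R (C x) = x" for x
    by (metis blinfun_apply_blinfun_compose blinfun.diff_left blinfun.diff_right blinfun_apply_id_blinfun id_apply scaleR_one)
  note comm = calculus_C_commute[OF R]
  have PQP: "P (Q (P x)) = P x - C (P x)" "Q (P (Q x)) = Q x - C (Q x)" for x
    by (simp_all add: C_apply blinfun.bilinear_simps)
  \<comment> \<open>This and \<open>RQPQ\<close> say that \<open>P\<close> maps \<open>Ran Q\<close>
    bijectively onto \<open>Ran P\<close>, with inverse \<open>Q R\<close>.\<close>
  have PQRP: "P (Q (R (P x))) = P x" for x
    using inv[of "P x"] by (simp add: comm PQP blinfun.diff_right)
  have RQPQ: "R (Q (P (Q x))) = Q x" for x
    using inv[of "Q x"] by (simp add: PQP blinfun.diff_right)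
  define X where "X = (id_blinfun - P) o\<^sub>L Q o\<^sub>L R o\<^sub>L P"
  have X: "X x = Q (R (P x)) - P x" for x
    by (simp add: X_def blinfun.bilinear_simps PQRP)
  have "is_angular_operator P Q X"
    unfolding is_angular_operator_def
  proof
    have "perp P o\<^sub>L X o\<^sub>L P = X"
      by (rule blinfun_eqI) (simp add: X perp_def blinfun.bilinear_simps PQRP)
    moreover have "complex_homogeneous X" unfolding X_def
      by (intro complex_homogeneous_intros hom C.calculus_hom[OF R])
    ultimately show "X \<in> subspace_ops P (perp P)" by (simp add: subspace_ops_def)
    show "range Q = {x + X x |x. x \<in> range P}"
    proof safe
      fix x
      have "P (Q x) + X (P (Q x)) = Q x"
        by (simp add: X comm RQPQ)
      then show "\<exists>y. Q x = y + X y \<and> y \<in> range P" by (metis rangeI)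
    next
      fix x
      show "P x + X (P x) \<in> range Q" by (simp add: X)
    qed
  qed
  then show thesis by (rule that)
qed

section \<open>The geodesic between two projections at distance less than one\<close>

definition U :: "'a \<Rightarrow>\<^sub>L 'a" where "U = 2 *\<^sub>R P - id_blinfun"

text \<open>Equal to \<open>P Q (I - P) + (I - P) Q P\<close>, the part of \<open>Q\<close>
  exchanging \<open>Ran P\<close> and its complement.\<close>

definition W :: "'a \<Rightarrow>\<^sub>L 'a" where "W = (P o\<^sub>L Q) + (Q o\<^sub>L P) - 2 *\<^sub>R (P o\<^sub>L Q o\<^sub>L P)"

text \<open>A diagonal reflection and an off-diagonal operator with coefficients that are functions
  of \<open>C\<close>. The points of the geodesic minus half the identity have this form, and so
  have their differences.\<close>

definition S :: "('a \<Rightarrow>\<^sub>L 'a) \<Rightarrow> ('a \<Rightarrow>\<^sub>L 'a) \<Rightarrow> ('a \<Rightarrow>\<^sub>L 'a)" where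
  "S A B = (1/2) *\<^sub>R (A o\<^sub>L U) + (B o\<^sub>L W)"

lemma U_apply: "U x = 2 *\<^sub>R P x - x"
  by (simp add: U_def blinfun.bilinear_simps)

lemma W_apply: "W x = P (Q x) + Q (P x) - 2 *\<^sub>R P (Q (P x))"
  by (simp add: W_def blinfun.bilinear_simps)

text \<open>In block form for \<open>P\<close>, \<open>U\<close> is diagonal with entries
  \<open>I\<close> and \<open>-I\<close> and \<open>W\<close> is off-diagonal, hence they
  anticommute.\<close>

lemma U_U: "U (U x) = x" and W_U: "W (U x) = - U (W x)" and W_W: "W (W x) = C x - C (C x)"
  by (simp_all add: U_apply W_apply C_apply blinfun.bilinear_simps algebra_simps scaleR_2)

lemma W_sym: "symmetric_op W"
  using sym unfolding symmetric_op_def W_apply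
  by (simp add: inner_add_left inner_add_right inner_diff_left inner_diff_right)

context
  fixes a b A B
  assumes A: "has_calculus id_blinfun C a A" and B: "has_calculus id_blinfun C b B"
begin

lemma U_A: "U (A x) = A (U x)" and U_B: "U (B x) = B (U x)"
  and W_A: "W (A x) = A (W x)" and W_B: "W (B x) = B (W x)"
  by (simp_all add: U_apply W_apply calculus_C_commute[OF A] calculus_C_commute[OF B] blinfun.bilinear_simps)

text \<open>The cross terms cancel by anticommutation; \<open>U ^ 2 = I\<close> and
  \<open>W ^ 2 = C (I - C)\<close> leave a function of \<open>C\<close>.\<close>

lemma calculus_S:
  "has_calculus id_blinfun C (\<lambda>x. (a x)\<^sup>2 / 4 + (b x)\<^sup>2 * (x * (1 - x))) (S A B o\<^sub>L S A B)"
proof -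
  have AB: "A (B x) = B (A x)" for x
    by (rule C.calculus_commute[OF A]) (simp_all add: calculus_C_commute[OF B])
  have "has_calculus id_blinfun C (\<lambda>x. (1/4) * (a x * a x) + (b x * b x) * (x * (1 - x)))
    ((1/4) *\<^sub>R (A o\<^sub>L A) + ((B o\<^sub>L B) o\<^sub>L (C o\<^sub>L (1 *\<^sub>R id_blinfun - C))))"
    by (intro C.calculus_add C.calculus_scaleR C.calculus_mult C.calculus_diff C.calculus_const C.calculus_id A B)
  moreover have "(1/4) *\<^sub>R (A o\<^sub>L A) + ((B o\<^sub>L B) o\<^sub>L (C o\<^sub>L (1 *\<^sub>R id_blinfun - C))) = S A B o\<^sub>L S A B"
    by (rule blinfun_eqI) (simp add: S_def blinfun.bilinear_simps U_A U_B W_A W_B U_U W_U W_W AB scaleR_diff_right)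
  ultimately show ?thesis by (simp add: power2_eq_square)
qed

lemma S_sym: "symmetric_op (S A B)"
proof -
  have "symmetric_op U" unfolding U_def by (intro symmetric_op_diff symmetric_op_scaleR symmetric_op_id sym)
  then show ?thesis unfolding S_def
    by (intro symmetric_op_add symmetric_op_scaleR symmetric_op_compose W_sym C.calculus_sym[OF A] C.calculus_sym[OF B])
      (simp_all add: U_A W_B)
qed

lemma S_hom: "complex_homogeneous (S A B)"
  unfolding S_def U_def W_def
  by (intro complex_homogeneous_intros hom C.calculus_hom[OF A] C.calculus_hom[OF B])

text \<open>Turns a norm estimate along the path into a scalar inequality on
  \<open>{0..d\<^sup>2}\<close>.\<close>

lemma norm_S_le:
  assumes "\<And>x. x \<in> {0..d\<^sup>2} \<Longrightarrow> (a x)\<^sup>2 / 4 + (b x)\<^sup>2 * (x * (1 - x)) \<le> M\<^sup>2" "0 \<le> M"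
  shows "norm (S A B) \<le> M"
proof -
  have "norm (S A B o\<^sub>L S A B) \<le> M\<^sup>2"
  proof (rule C.calculus_norm_le[OF calculus_S])
    fix x assume "x \<in> approx_spectrum id_blinfun C"
    then have x: "x \<in> {0..d\<^sup>2}" using spectrum_C by blast
    then have "0 \<le> x * (1 - x)" using d2_less_1 by simp
    then show "\<bar>(a x)\<^sup>2 / 4 + (b x)\<^sup>2 * (x * (1 - x))\<bar> \<le> M\<^sup>2" using assms(1)[OF x] by simp
  qed simp
  then have "(norm (S A B))\<^sup>2 \<le> M\<^sup>2" using norm_power2_le_norm_compose[OF S_sym] by linarith
  then show ?thesis by (rule power2_le_imp_le) (rule assms(2))
qed

end

text \<open>In the eigenspace of \<open>C\<close> for \<open>sin \<phi> ^ 2\<close> the ranges of \<open>P\<close> and \<open>Q\<close> form the angle \<open>\<phi>\<close>; there the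
  geodesic is the projection onto the line at angle \<open>t * \<phi>\<close> from \<open>Ran P\<close>, written in terms of \<open>P\<close>, \<open>C\<close>
  and the off-diagonal part \<open>W\<close> of \<open>Q\<close>.\<close>

lemma lipschitz_path_exists:
  obtains \<gamma> where "\<gamma> 0 = P" "\<gamma> 1 = Q" "\<And>t. \<gamma> t \<in> orth_projections"
    "\<And>s t. s \<in> {0..1} \<Longrightarrow> t \<in> {0..1} \<Longrightarrow> norm (\<gamma> s - \<gamma> t) \<le> proj_angle P Q * \<bar>s - t\<bar>"
proof -
  define \<theta> where "\<theta> = proj_angle P Q"
  have \<theta>: "0 \<le> \<theta>" "\<theta> < pi / 2"
    using proj_angle_bounds(1)[OF P Q] arcsin_less_arcsin[of d 1] less_1 norm_ge_zero[of "P - Q"]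
    by (auto simp: \<theta>_def proj_angle_def simp del: norm_ge_zero)
  define \<phi> where "\<phi> = (\<lambda>x. arcsin (sqrt x))"
  have \<phi>: "0 \<le> \<phi> x" "\<phi> x \<le> \<theta>" "(sin (\<phi> x))\<^sup>2 = x" if "x \<in> {0..d\<^sup>2}" for x
  proof -
    have x: "0 \<le> sqrt x" "sqrt x \<le> d" using that real_le_lsqrt by auto
    have "arcsin 0 \<le> arcsin (sqrt x)" by (rule arcsin_le_arcsin) (use x less_1 in linarith)+
    then show "0 \<le> \<phi> x" by (simp add: \<phi>_def)
    show "\<phi> x \<le> \<theta>" unfolding \<phi>_def \<theta>_def proj_angle_def
      by (rule arcsin_le_arcsin) (use x less_1 in linarith)+
    have "sin (\<phi> x) = sqrt x" unfolding \<phi>_def using x less_1 by (intro sin_arcsin) linarith+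
    then show "(sin (\<phi> x))\<^sup>2 = x" using that by simp
  qed
  have cont: "continuous_on {0..d\<^sup>2} \<phi>"
    unfolding \<phi>_def by (intro continuous_intros) (use d2_less_1 in \<open>auto intro: order_trans[of "-1" 0]\<close>)
  define f where "f = (\<lambda>t x. cos (2 * t * \<phi> x))"
  \<comment> \<open>The quotient of \<open>sin (2 * t * \<phi> x)\<close> by
    \<open>sin (2 * \<phi> x)\<close>, continued by \<open>t\<close> at \<open>\<phi> x = 0\<close>.
    The denominator occurs because \<open>W ^ 2\<close> has the scalar value
    \<open>x * (1 - x)\<close>, the square of \<open>sin (2 * \<phi> x) / 2\<close>.\<close>
  define g where "g = (\<lambda>t x. t * sinc (2 * t * \<phi> x) / sinc (2 * \<phi> x))"
  \<comment> \<open>\<open>\<theta> < pi / 2\<close> keeps \<open>2 * \<phi> x\<close> below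
    \<open>pi\<close>.\<close>
  have sinc_pos: "0 < sinc (2 * \<phi> x)" if "x \<in> {0..d\<^sup>2}" for x
    using \<phi>(1,2)[OF that] \<theta>(2) by (auto simp: sinc_def intro!: divide_pos_pos sin_gt_zero)
  have sinc_cont: "continuous_on {0..d\<^sup>2} (\<lambda>x. sinc (c * \<phi> x))" for c
    by (rule continuous_on_compose2[OF continuous_on_sinc[of UNIV]]) (auto intro: continuous_intros cont)
  have "\<exists>A. has_calculus id_blinfun C (f t) A" for t
    unfolding f_def by (intro calculus_C_exists continuous_intros cont)
  then obtain F where F: "\<And>t. has_calculus id_blinfun C (f t) (F t)" by metis
  have "\<exists>A. has_calculus id_blinfun C (g t) A" for t
    unfolding g_def by (intro calculus_C_exists continuous_intros sinc_cont) (use sinc_pos in force)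
  then obtain G where G: "\<And>t. has_calculus id_blinfun C (g t) (G t)" by metis
  have g: "g t x * (2 * sin (\<phi> x) * cos (\<phi> x)) = sin (2 * t * \<phi> x)" if "x \<in> {0..d\<^sup>2}" for t x
  proof -
    have "g t x * sin (2 * \<phi> x) = t * sinc (2 * t * \<phi> x) / sinc (2 * \<phi> x) * (2 * \<phi> x * sinc (2 * \<phi> x))"
      by (simp add: g_def mult_sinc)
    also have "\<dots> = 2 * t * \<phi> x * sinc (2 * t * \<phi> x)" using sinc_pos[OF that] by simp
    finally show ?thesis by (simp add: mult_sinc sin_double)
  qed
  have x_eq: "4 * (x * (1 - x)) = (2 * sin (\<phi> x) * cos (\<phi> x))\<^sup>2" if "x \<in> {0..d\<^sup>2}" for x
    using \<phi>(3)[OF that] by (simp add: power_mult_distrib cos_squared_eq)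
  define \<gamma> where "\<gamma> = (\<lambda>t. (1/2) *\<^sub>R id_blinfun + S (F t) (G t))"
  have "\<gamma> 0 = P"
  proof -
    have "F 0 = 1 *\<^sub>R id_blinfun" by (rule C.calculus_unique[OF F C.calculus_const]) (simp add: f_def)
    moreover have "G 0 = 0 *\<^sub>R id_blinfun" by (rule C.calculus_unique[OF G C.calculus_const]) (simp add: g_def)
    ultimately show ?thesis
      by (intro blinfun_eqI) (simp add: \<gamma>_def S_def U_apply blinfun.bilinear_simps algebra_simps)
  qed
  moreover have "\<gamma> 1 = Q"
  proof -
    have F1: "F 1 = 1 *\<^sub>R id_blinfun - 2 *\<^sub>R C"
      by (rule C.calculus_unique[OF F C.calculus_diff[OF C.calculus_const C.calculus_scaleR[OF C.calculus_id]]])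
        (use \<phi>(3) spectrum_C in \<open>auto simp: f_def cos_double_sin\<close>)
    have G1: "G 1 = 1 *\<^sub>R id_blinfun"
      by (rule C.calculus_unique[OF G C.calculus_const]) (use sinc_pos spectrum_C in \<open>force simp: g_def\<close>)
    show ?thesis
    proof (rule blinfun_eqI)
      fix x
      have "\<gamma> 1 x = (1/2) *\<^sub>R x + (1/2) *\<^sub>R (U x - 2 *\<^sub>R C (U x)) + W x"
        by (simp add: \<gamma>_def S_def F1 G1 blinfun.bilinear_simps del: scaleR_diff_right)
      also have "(1/2) *\<^sub>R (U x - 2 *\<^sub>R C (U x)) = P x - (1/2) *\<^sub>R x - 2 *\<^sub>R C (P x) + C x"
        by (simp add: U_apply blinfun.bilinear_simps scaleR_diff_right)
      also have "(1/2) *\<^sub>R x + \<dots> + W x = Q x"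
        by (simp add: W_apply C_apply blinfun.bilinear_simps scaleR_2)
      finally show "\<gamma> 1 x = Q x" .
    qed
  qed
  moreover have "\<gamma> t \<in> orth_projections" for t
  proof -
    have F2: "has_calculus id_blinfun C (\<lambda>x. 2 * f t x) (2 *\<^sub>R F t)" and G2: "has_calculus id_blinfun C (\<lambda>x. 2 * g t x) (2 *\<^sub>R G t)"
      by (intro C.calculus_scaleR F G)+
    \<comment> \<open>\<open>?V\<close> is \<open>2 * \<gamma> t - I\<close>. It squares to the
      identity because \<open>cos ^ 2 + sin ^ 2 = 1\<close>, which makes \<open>\<gamma> t\<close>
      idempotent.\<close>
    let ?V = "S (2 *\<^sub>R F t) (2 *\<^sub>R G t)"
    have "?V o\<^sub>L ?V = 1 *\<^sub>R id_blinfun"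
    proof (rule C.calculus_unique[OF calculus_S[OF F2 G2] C.calculus_const])
      fix x assume "x \<in> approx_spectrum id_blinfun C"
      then have x: "x \<in> {0..d\<^sup>2}" using spectrum_C by blast
      have "(2 * f t x)\<^sup>2 / 4 + (2 * g t x)\<^sup>2 * (x * (1 - x)) = (f t x)\<^sup>2 + (g t x)\<^sup>2 * (4 * (x * (1 - x)))"
        by (simp add: power_mult_distrib)
      also have "\<dots> = (f t x)\<^sup>2 + (g t x * (2 * sin (\<phi> x) * cos (\<phi> x)))\<^sup>2"
        by (simp only: x_eq[OF x] power_mult_distrib)
      also have "\<dots> = 1" unfolding g[OF x] f_def by simp
      finally show "(2 * f t x)\<^sup>2 / 4 + (2 * g t x)\<^sup>2 * (x * (1 - x)) = 1" .
    qed
    then have VV: "?V (?V x) = x" for x by (metis blinfun_apply_blinfun_compose blinfun_apply_id_blinfun id_apply scaleR_one)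
    have \<gamma>V: "\<gamma> t = (1/2) *\<^sub>R (id_blinfun + ?V)"
      by (rule blinfun_eqI) (simp add: \<gamma>_def S_def blinfun.bilinear_simps algebra_simps)
    have "\<gamma> t (\<gamma> t x) = \<gamma> t x" for x
      unfolding \<gamma>V by (simp add: blinfun.bilinear_simps VV algebra_simps flip: scaleR_add_left)
    moreover have "symmetric_op (\<gamma> t)" unfolding \<gamma>V
      by (intro symmetric_op_scaleR symmetric_op_add symmetric_op_id S_sym[OF F2 G2])
    moreover have "complex_homogeneous (\<gamma> t)" unfolding \<gamma>V
      by (intro complex_homogeneous_intros S_hom[OF F2 G2])
    ultimately show ?thesis by (simp add: orth_projections_iff)
  qed
  moreover have "norm (\<gamma> s - \<gamma> t) \<le> \<theta> * \<bar>s - t\<bar>" if st: "s \<in> {0..1}" "t \<in> {0..1}" for s t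
  proof -
    have "norm (S (F s - F t) (G s - G t)) \<le> \<theta> * \<bar>s - t\<bar>"
    proof (rule norm_S_le[OF C.calculus_diff[OF F F] C.calculus_diff[OF G G]])
      fix x assume x: "x \<in> {0..d\<^sup>2}"
      define \<alpha> where "\<alpha> = 2 * s * \<phi> x"
      define \<beta> where "\<beta> = 2 * t * \<phi> x"
      \<comment> \<open>The scalar to be bounded is a quarter of the squared chord between the
        angles \<open>\<alpha>\<close> and \<open>\<beta>\<close> on the unit circle, that is
        \<open>sin ((\<alpha> - \<beta>) / 2) ^ 2\<close>.\<close>
      have "(g s x - g t x)\<^sup>2 * (x * (1 - x)) = ((g s x - g t x) * (2 * sin (\<phi> x) * cos (\<phi> x)))\<^sup>2 / 4"
        unfolding power_mult_distrib[of "g s x - g t x"] x_eq[OF x, symmetric] by simp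
      also have "\<dots> = (sin \<alpha> - sin \<beta>)\<^sup>2 / 4"
        unfolding left_diff_distrib g[OF x] \<alpha>_def \<beta>_def by simp
      finally have "(f s x - f t x)\<^sup>2 / 4 + (g s x - g t x)\<^sup>2 * (x * (1 - x))
          = ((cos \<alpha> - cos \<beta>)\<^sup>2 + (sin \<alpha> - sin \<beta>)\<^sup>2) / 4"
        by (simp add: f_def \<alpha>_def \<beta>_def)
      also have "\<dots> = (1 - cos (\<alpha> - \<beta>)) / 2"
      proof -
        have "(cos \<alpha> - cos \<beta>)\<^sup>2 + (sin \<alpha> - sin \<beta>)\<^sup>2
            = ((cos \<alpha>)\<^sup>2 + (sin \<alpha>)\<^sup>2) + ((cos \<beta>)\<^sup>2 + (sin \<beta>)\<^sup>2) - 2 * cos (\<alpha> - \<beta>)"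
          unfolding cos_diff by (simp add: power2_diff algebra_simps del: sin_cos_squared_add sin_cos_squared_add2)
        then show ?thesis by simp
      qed
      also have "\<dots> = (sin ((\<alpha> - \<beta>) / 2))\<^sup>2"
      proof -
        have "2 * ((\<alpha> - \<beta>) / 2) = \<alpha> - \<beta>" by simp
        then have "cos (\<alpha> - \<beta>) = 1 - 2 * (sin ((\<alpha> - \<beta>) / 2))\<^sup>2"
          using cos_double_sin[of "(\<alpha> - \<beta>) / 2"] by metis
        then show ?thesis by argo
      qed
      also have "(\<alpha> - \<beta>) / 2 = (s - t) * \<phi> x" by (simp add: \<alpha>_def \<beta>_def left_diff_distrib diff_divide_distrib)
      also have "(sin ((s - t) * \<phi> x))\<^sup>2 \<le> ((s - t) * \<phi> x)\<^sup>2"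
        using abs_sin_x_le_abs_x[of "(s - t) * \<phi> x"] by (simp only: abs_le_square_iff)
      also have "\<dots> = (s - t)\<^sup>2 * (\<phi> x)\<^sup>2" by (rule power_mult_distrib)
      also have "\<dots> \<le> (s - t)\<^sup>2 * \<theta>\<^sup>2" using \<phi>(1,2)[OF x] by (intro mult_left_mono power_mono) auto
      finally show "(f s x - f t x)\<^sup>2 / 4 + (g s x - g t x)\<^sup>2 * (x * (1 - x)) \<le> (\<theta> * \<bar>s - t\<bar>)\<^sup>2"
        by (simp add: power_mult_distrib mult.commute)
    qed (use \<theta> in simp)
    moreover have "\<gamma> s - \<gamma> t = S (F s - F t) (G s - G t)"
      by (rule blinfun_eqI) (simp add: \<gamma>_def S_def blinfun.bilinear_simps algebra_simps)
    ultimately show ?thesis by simp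
  qed
  ultimately show thesis using that unfolding \<theta>_def by blast
qed

end

section \<open>The operator angle\<close>

text \<open>The \<open>P\<close>-component of a graph vector is its base point, so
  \<open>Ran Q\<close> determines the operator.\<close>

lemma angular_operator_eqI:
  fixes P Q X :: "'a::chilbert_space \<Rightarrow>\<^sub>L 'a"
  assumes P: "P \<in> orth_projections" and X: "is_angular_operator P Q X"
  shows "angular_operator P Q = X"
  unfolding angular_operator_def
proof (rule the_equality[where P="is_angular_operator P Q", OF X])
  fix Y assume Y: "is_angular_operator P Q Y"
  have YP: "Z (P x) = Z x" "P (Z x) = 0" if "is_angular_operator P Q Z" for x Z
  proof -
    have "perp P o\<^sub>L Z o\<^sub>L P = Z" using that by (simp add: is_angular_operator_def subspace_ops_def)
    then have Z: "Z x = Z (P x) - P (Z (P x))" for x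
      by (metis blinfun_apply_blinfun_compose blinfun.diff_left blinfun_apply_id_blinfun id_apply perp_def)
    then show "Z (P x) = Z x" by (metis orth_projectionD(1)[OF P])
    show "P (Z x) = 0" using Z[of x] by (metis blinfun.diff_right cancel_comm_monoid_add_class.diff_cancel orth_projectionD(1)[OF P])
  qed
  show "Y = X"
  proof (rule blinfun_eqI)
    fix x
    have "P x + Y (P x) \<in> range Q" using Y unfolding is_angular_operator_def by blast
    then obtain z where z: "P x + Y (P x) = P z + X (P z)" using X unfolding is_angular_operator_def by auto
    then have "P (P x + Y (P x)) = P (P z + X (P z))" by simp
    then have "P x = P z"
      using YP(2)[OF X] YP(2)[OF Y] by (simp add: blinfun.add_right orth_projectionD(1)[OF P])
    then show "Y x = X x" using z YP(1)[OF X] YP(1)[OF Y] by (metis add_left_cancel)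
  qed
qed

locale angular_pair =
  fixes P Q X :: "'a::chilbert_space \<Rightarrow>\<^sub>L 'a"
  assumes P: "P \<in> orth_projections" and Q: "Q \<in> orth_projections" and X: "is_angular_operator P Q X"
begin

lemma P_P [simp]: "P (P x) = P x" and Q_Q [simp]: "Q (Q x) = Q x"
  by (simp_all add: orth_projectionD(1)[OF P] orth_projectionD(1)[OF Q])

lemma perp_X_P: "X x = X (P x) - P (X (P x))"
proof -
  have "perp P o\<^sub>L X o\<^sub>L P = X" using X by (simp add: is_angular_operator_def subspace_ops_def)
  then show ?thesis
    by (metis blinfun_apply_blinfun_compose blinfun.diff_left blinfun_apply_id_blinfun id_apply perp_def)
qed

lemma X_P [simp]: "X (P x) = X x"
  by (metis P_P perp_X_P)

lemma P_X [simp]: "P (X x) = 0"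
  using perp_X_P[of x] by (metis P_P blinfun.diff_right diff_self)

lemma X_hom: "complex_homogeneous X"
  using X by (simp add: is_angular_operator_def subspace_ops_def)

lemma Q_graph: "Q (P x + X x) = P x + X x"
proof -
  have "P x + X (P x) \<in> range Q" using X unfolding is_angular_operator_def by blast
  then show ?thesis by (metis X_P Q_Q rangeE)
qed

lemma Q_eq: "Q x = P (Q x) + X (Q x)"
proof -
  have "range Q = {x + X x |x. x \<in> range P}" using X unfolding is_angular_operator_def by blast
  then obtain z where z: "Q x = P z + X (P z)" by blast
  then have "P (Q x) = P z" by (simp add: blinfun.add_right)
  then show ?thesis using z by (metis X_P)
qed

lemma norm_graph: "(norm (P x + X x))\<^sup>2 = (norm (P x))\<^sup>2 + (norm (X x))\<^sup>2"
proof -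
  have "inner (P x) (X x) = 0" by (simp add: orth_projectionD(2)[OF P])
  then show ?thesis unfolding power2_norm_eq_inner by (simp add: inner_add_left inner_add_right inner_commute)
qed

lemma norm_X_apply_le: "norm (X x) \<le> norm X * norm (P x)"
  using norm_blinfun[of X "P x"] by simp

text \<open>For vectors of \<open>Ran Q\<close> the defect from \<open>Ran P\<close> is
  \<open>X (Q x)\<close>, bounded by Pythagoras. For vectors of \<open>Ran P\<close> the projection
  to \<open>Ran Q\<close> is bounded below by pairing with a graph vector.\<close>

lemma norm_diff_le_sin_arctan: "norm (P - Q) \<le> sin (arctan (norm X))"
proof (rule norm_orth_projection_diff_le[OF P Q])
  define k where "k = norm X"
  have k: "0 \<le> k" by (simp add: k_def)
  show s: "0 \<le> sin (arctan (norm X))" by (simp add: sin_arctan)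
  have pos: "0 < 1 + k\<^sup>2" by (simp add: add_pos_nonneg)
  have s2: "(sin (arctan (norm X)))\<^sup>2 = k\<^sup>2 / (1 + k\<^sup>2)"
    using pos by (simp add: sin_arctan power_divide k_def)
  have X_le: "(norm (X x))\<^sup>2 \<le> k\<^sup>2 * (norm (P x))\<^sup>2" for x
    using power_mono[OF norm_X_apply_le norm_ge_zero, of x 2] by (simp add: power_mult_distrib k_def)
  show "norm (Q x - P (Q x)) \<le> sin (arctan (norm X)) * norm (Q x)" for x
  proof (rule power2_le_imp_le)
    have "(norm (Q x))\<^sup>2 = (norm (P (Q x)))\<^sup>2 + (norm (X (Q x)))\<^sup>2"
      using norm_graph[of "Q x"] Q_eq[of x] by simp
    then have "(1 + k\<^sup>2) * (norm (X (Q x)))\<^sup>2 \<le> k\<^sup>2 * (norm (Q x))\<^sup>2"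
      using X_le[of "Q x"] by (simp add: algebra_simps)
    then have "(norm (X (Q x)))\<^sup>2 \<le> k\<^sup>2 / (1 + k\<^sup>2) * (norm (Q x))\<^sup>2"
      using pos by (simp add: pos_le_divide_eq mult.commute)
    moreover have "Q x - P (Q x) = X (Q x)" using Q_eq[of x] by (simp add: algebra_simps)
    ultimately show "(norm (Q x - P (Q x)))\<^sup>2 \<le> (sin (arctan (norm X)) * norm (Q x))\<^sup>2"
      by (simp add: power_mult_distrib s2)
  qed (use s in simp)
  show "norm (P x - Q (P x)) \<le> sin (arctan (norm X)) * norm (P x)" for x
  proof (cases "P x = 0")
    case False
    then have px: "0 < (norm (P x))\<^sup>2" by simp
    show ?thesis
    proof (rule power2_le_imp_le)
      \<comment> \<open>The graph vector over \<open>P x\<close>; it is fixed by \<open>Q\<close>,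
        so Cauchy-Schwarz with it bounds \<open>norm (Q (P x))\<close> from below.\<close>
      define y where "y = P x + X x"
      have "inner (P x) (X x) = 0" by (simp add: orth_projectionD(2)[OF P])
      then have "(norm (P x))\<^sup>2 = inner (P x) y"
        by (simp add: y_def inner_add_right power2_norm_eq_inner)
      also have "\<dots> = inner (Q (P x)) y"
        using Q_graph[of x] by (simp add: y_def orth_projectionD(2)[OF Q, of "P x"])
      also have "\<dots> \<le> norm (Q (P x)) * norm y" by (rule norm_cauchy_schwarz)
      finally have "((norm (P x))\<^sup>2)\<^sup>2 \<le> (norm (Q (P x)) * norm y)\<^sup>2" by (rule power_mono) simp
      also have "\<dots> = (norm (Q (P x)))\<^sup>2 * (norm y)\<^sup>2" by (rule power_mult_distrib)
      also have "(norm y)\<^sup>2 \<le> (1 + k\<^sup>2) * (norm (P x))\<^sup>2"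
        using X_le[of x] unfolding y_def norm_graph by (simp add: algebra_simps)
      finally have "(norm (P x))\<^sup>2 * (norm (P x))\<^sup>2 \<le> ((1 + k\<^sup>2) * (norm (Q (P x)))\<^sup>2) * (norm (P x))\<^sup>2"
        by (simp add: mult_left_mono power2_eq_square mult.assoc mult.left_commute)
      then have "(norm (P x))\<^sup>2 \<le> (1 + k\<^sup>2) * (norm (Q (P x)))\<^sup>2"
        by (rule mult_right_le_imp_le) (rule px)
      then have "(1 + k\<^sup>2) * (norm (P x - Q (P x)))\<^sup>2 \<le> k\<^sup>2 * (norm (P x))\<^sup>2"
        unfolding orth_projection_pythagoras[OF Q, of "P x", symmetric] by (simp add: algebra_simps)
      then have "(norm (P x - Q (P x)))\<^sup>2 \<le> k\<^sup>2 / (1 + k\<^sup>2) * (norm (P x))\<^sup>2"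
        using pos by (simp add: pos_le_divide_eq mult.commute)
      then show "(norm (P x - Q (P x)))\<^sup>2 \<le> (sin (arctan (norm X)) * norm (P x))\<^sup>2"
        by (simp add: power_mult_distrib s2)
    qed (use s in simp)
  qed simp
qed

text \<open>For the lower bound, \<open>X x\<close> is \<open>Q - P\<close> applied to the graph
  vector \<open>P x + X x\<close>; solving the squared estimate for \<open>norm (X x)\<close> gives
  the tangent of the angle.\<close>

lemma proj_angle_eq_arctan: "proj_angle P Q = arctan (norm X)"
proof (rule antisym)
  have "norm (P - Q) \<le> sin (arctan (norm X))" by (rule norm_diff_le_sin_arctan)
  then show "proj_angle P Q \<le> arctan (norm X)" by (rule proj_angle_leI[OF P Q]) simp
  let ?\<theta> = "proj_angle P Q"
  \<comment> \<open>The first inequality keeps the angle strictly below \<open>pi / 2\<close>, so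
    that its tangent may be used.\<close>
  have "arcsin (norm (P - Q)) \<le> arcsin (sin (arctan (norm X)))"
    by (rule arcsin_le_arcsin) (use norm_diff_le_sin_arctan norm_ge_zero[of "P - Q"] in \<open>simp_all del: norm_ge_zero\<close>)
  also have "\<dots> = arctan (norm X)"
    using arctan_bounded[of "norm X"] by (intro arcsin_sin) auto
  also have "\<dots> < pi / 2" by (rule arctan_ubound)
  finally have \<theta>: "0 \<le> ?\<theta>" "?\<theta> < pi / 2" using proj_angle_bounds(1)[OF P Q] by (auto simp: proj_angle_def)
  then have cos: "0 < cos ?\<theta>" by (intro cos_gt_zero_pi) auto
  have sin: "0 \<le> sin ?\<theta>" using \<theta> by (intro sin_ge_zero) auto
  have tan: "0 \<le> tan ?\<theta>" using cos sin by (simp add: tan_def)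
  have "norm X \<le> tan ?\<theta>"
  proof (rule norm_blinfun_bound[OF tan])
    fix x
    let ?y = "P x + X x"
    have "X x = (Q - P) ?y"
      using Q_graph[of x] by (simp add: blinfun.diff_left) (simp add: blinfun.add_right)
    then have "norm (X x) \<le> norm (Q - P) * norm ?y" by (metis norm_blinfun)
    then have "(norm (X x))\<^sup>2 \<le> (norm (Q - P) * norm ?y)\<^sup>2" by (rule power_mono) simp
    also have "\<dots> = (sin ?\<theta>)\<^sup>2 * ((norm (P x))\<^sup>2 + (norm (X x))\<^sup>2)"
      by (simp only: power_mult_distrib norm_graph sin_proj_angle[OF P Q] norm_minus_commute[of Q P])
    finally have "(cos ?\<theta>)\<^sup>2 * (norm (X x))\<^sup>2 \<le> (sin ?\<theta>)\<^sup>2 * (norm (P x))\<^sup>2"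
      by (simp add: cos_squared_eq algebra_simps)
    then have "(cos ?\<theta> * norm (X x))\<^sup>2 \<le> (sin ?\<theta> * norm (P x))\<^sup>2" by (simp add: power_mult_distrib)
    then have "cos ?\<theta> * norm (X x) \<le> sin ?\<theta> * norm (P x)" by (rule power2_le_imp_le) (use sin in simp)
    then have "norm (X x) \<le> tan ?\<theta> * norm (P x)" using cos by (simp add: tan_def field_simps)
    also have "\<dots> \<le> tan ?\<theta> * norm x" by (intro mult_left_mono norm_orth_projection_le[OF P] tan)
    finally show "norm (X x) \<le> tan ?\<theta> * norm x" .
  qed
  then have "arctan (norm X) \<le> arctan (tan ?\<theta>)" by (rule arctan_monotone')
  then show "arctan (norm X) \<le> ?\<theta>" using \<theta> by (simp add: arctan_tan)
qed

text \<open>The upper bound follows spectral bounds through the square root and the arctangent. For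
  the lower bound, \<open>norm X ^ 2\<close> is an approximate eigenvalue of
  \<open>cadjoint X o\<^sub>L X\<close>, and spectral mapping carries it to
  \<open>arctan (norm X)\<close>.\<close>

lemma norm_operator_angle: "norm (operator_angle P Q) = arctan (norm X)"
proof -
  define T where "T = cadjoint X o\<^sub>L X"
  have inner_T: "inner (T x) y = inner (X x) (X y)" "inner x (T y) = inner (X x) (X y)" for x y
    by (simp_all add: T_def inner_cadjoint[OF X_hom] inner_cadjoint_right[OF X_hom])
  have TP: "T (P x) = T x" for x by (simp add: T_def)
  have PT: "P (T x) = T x" for x
    by (rule inner_ext) (simp add: orth_projectionD(2)[OF P] inner_T)
  interpret T: selfadjoint_operator P T
  proof
    show "T \<in> subspace_ops P P"
      unfolding subspace_ops_iff[OF P P] T_def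
      using complex_homogeneous_compose[OF complex_homogeneous_cadjoint[OF X_hom] X_hom] TP PT by (simp add: T_def)
    show "symmetric_op T" by (simp add: symmetric_op_def inner_T)
  qed (rule P)
  obtain B where B: "has_calculus P T sqrt B"
    using T.calculus_exists[OF _ T.approx_spectrum_subset] continuous_on_real_sqrt[OF continuous_on_id] by blast
  interpret B: selfadjoint_operator P B by (rule T.calculus_operator[OF B])
  have arctan_cont: "continuous_on A arctan" for A :: "real set" by (intro continuous_intros)
  obtain \<Theta> where \<Theta>: "has_calculus P B arctan \<Theta>"
    using B.calculus_exists[OF arctan_cont B.approx_spectrum_subset] by blast
  have "fun_calc_on P sqrt T = B"
    by (rule T.fun_calc_on_eqI[OF _ B]) (intro continuous_intros)
  moreover have "fun_calc_on P arctan B = \<Theta>"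
    by (rule B.fun_calc_on_eqI[OF arctan_cont \<Theta>])
  ultimately have angle: "operator_angle P Q = \<Theta>"
    by (simp add: operator_angle_def angular_operator_eqI[OF P X] T_def)
  have "norm T \<le> norm (cadjoint X) * norm X" unfolding T_def by (rule norm_blinfun_compose)
  also have "\<dots> \<le> norm X * norm X"
    by (intro mult_right_mono norm_adjoint_le) (simp_all add: inner_cadjoint[OF X_hom])
  finally have norm_T: "norm T \<le> (norm X)\<^sup>2" by (simp add: power2_eq_square)
  have "norm B \<le> norm X"
  proof (rule T.calculus_norm_le[OF B])
    fix t assume "t \<in> approx_spectrum P T"
    then have "\<bar>t\<bar> \<le> (norm X)\<^sup>2" using approx_spectrum_norm_le norm_T by fastforce
    then have "sqrt \<bar>t\<bar> \<le> norm X" by (intro real_le_lsqrt) auto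
    \<comment> \<open>Only \<open>\<bar>t\<bar>\<close> is bounded here; \<open>sqrt\<close> is odd
      on the reals, so negative \<open>t\<close> obeys the same bound.\<close>
    then show "\<bar>sqrt t\<bar> \<le> norm X" by (cases "0 \<le> t") (auto simp: real_sqrt_minus abs_if)
  qed simp
  have upper: "norm \<Theta> \<le> arctan (norm X)"
  proof (rule B.calculus_norm_le[OF \<Theta>])
    fix t assume "t \<in> approx_spectrum P B"
    then have "\<bar>t\<bar> \<le> norm X" using approx_spectrum_norm_le \<open>norm B \<le> norm X\<close> by fastforce
    then have "arctan t \<le> arctan (norm X)" "arctan (- t) \<le> arctan (norm X)"
      by (intro arctan_monotone'; simp)+
    then show "\<bar>arctan t\<bar> \<le> arctan (norm X)" by (simp add: arctan_minus)
  qed simp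
  have lower: "arctan (norm X) \<le> norm \<Theta>"
  proof (cases "\<exists>x. P x \<noteq> 0")
    case True
    have "\<not> bounded_below_on P (\<lambda>x. cadjoint X (X x) - (norm X)\<^sup>2 *\<^sub>R x)"
      by (rule norm_square_approx_eigenvalue)
        (use True in \<open>auto simp: inner_cadjoint[OF X_hom] norm_orth_projection_le[OF P]\<close>)
    then have "(norm X)\<^sup>2 \<in> approx_spectrum P T"
      using not_approx_spectrumD[of "(norm X)\<^sup>2" P T] by (auto simp: T_def)
    then have "arctan (sqrt ((norm X)\<^sup>2)) \<in> approx_spectrum P \<Theta>"
      by (intro B.approx_spectrum_calculus[OF \<Theta>] T.approx_spectrum_calculus[OF B])
    then show ?thesis using approx_spectrum_norm_le by fastforce
  next
    case False
    then have "X x = 0" for x using X_P[of x] by simp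
    then have "X = 0" by (intro blinfun_eqI) simp
    then show ?thesis by simp
  qed
  show ?thesis using angle upper lower by simp
qed

end

section \<open>Geodesics and the value of the length metric\<close>

lemma length_metric_le_proj_angle:
  fixes P Q :: "'a::chilbert_space \<Rightarrow>\<^sub>L 'a"
  assumes "P \<in> orth_projections" "Q \<in> orth_projections" "norm (P - Q) < 1"
  shows "\<exists>\<gamma>. geodesic_path orth_projections \<rho> P Q (proj_angle P Q) \<gamma>" "\<rho> P Q \<le> ennreal (proj_angle P Q)"
proof -
  interpret projection_pair P Q by unfold_locales (rule assms)+
  define \<theta> where "\<theta> = proj_angle P Q"
  have \<theta>: "0 \<le> \<theta>" unfolding \<theta>_def by (rule proj_angle_bounds(1)[OF P Q])
  obtain \<gamma> where \<gamma>: "\<gamma> 0 = P" "\<gamma> 1 = Q" "\<And>t. \<gamma> t \<in> orth_projections"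
    "\<And>s t. s \<in> {0..1} \<Longrightarrow> t \<in> {0..1} \<Longrightarrow> norm (\<gamma> s - \<gamma> t) \<le> \<theta> * \<bar>s - t\<bar>"
    unfolding \<theta>_def by (rule lipschitz_path_exists) blast
  have upper: "\<rho> (\<gamma> s) (\<gamma> t) \<le> ennreal (\<theta> * (t - s))" if "0 \<le> s" "s \<le> t" "t \<le> 1" for s t
    by (rule length_metric_lipschitz[OF that(2) \<theta>]) (use that in \<open>auto intro: \<gamma>(3) \<gamma>(4)\<close>)
  show "\<rho> P Q \<le> ennreal (proj_angle P Q)" using upper[of 0 1] \<gamma>(1,2) by (simp add: \<theta>_def)
  have angle_le: "proj_angle (\<gamma> s) (\<gamma> t) \<le> \<theta> * (t - s)" if "0 \<le> s" "s \<le> t" "t \<le> 1" for s t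
  proof -
    have "ennreal (proj_angle (\<gamma> s) (\<gamma> t)) \<le> ennreal (\<theta> * (t - s))"
      using proj_angle_le_length_metric upper[OF that] by (rule order_trans)
    then show ?thesis using \<theta> that by (simp add: ennreal_le_iff)
  qed
  \<comment> \<open>The pieces from \<open>P\<close> to \<open>\<gamma> s\<close> and from
    \<open>\<gamma> t\<close> to \<open>Q\<close> have angles at most \<open>\<theta> * s\<close>
    and \<open>\<theta> * (1 - t)\<close>, so the triangle inequality leaves at least
    \<open>\<theta> * (t - s)\<close> for the middle.\<close>
  have lower: "\<theta> * (t - s) \<le> proj_angle (\<gamma> s) (\<gamma> t)" if "0 \<le> s" "s \<le> t" "t \<le> 1" for s t
  proof -
    have "\<theta> \<le> proj_angle P (\<gamma> t) + proj_angle (\<gamma> t) Q" unfolding \<theta>_def by (rule proj_angle_triangle[OF P \<gamma>(3) Q])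
    moreover have "proj_angle P (\<gamma> t) \<le> proj_angle P (\<gamma> s) + proj_angle (\<gamma> s) (\<gamma> t)" by (rule proj_angle_triangle[OF P \<gamma>(3) \<gamma>(3)])
    ultimately show ?thesis
      using angle_le[of 0 s] angle_le[of t 1] that \<gamma>(1,2) by (simp add: algebra_simps)
  qed
  have dist: "\<rho> (\<gamma> s) (\<gamma> t) = ennreal (\<theta> * (t - s))" if "0 \<le> s" "s \<le> t" "t \<le> 1" for s t
    using upper[OF that] lower[OF that] proj_angle_le_length_metric[of "\<gamma> s" "\<gamma> t"]
    by (meson antisym ennreal_leI order_trans)
  \<comment> \<open>Geodesics require the distance in both orders; the reversed path gives the upper
    bound.\<close>
  have dist_rev: "\<rho> (\<gamma> t) (\<gamma> s) = ennreal (\<theta> * (t - s))" if "0 \<le> s" "s \<le> t" "t \<le> 1" for s t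
  proof (rule antisym)
    show "ennreal (\<theta> * (t - s)) \<le> \<rho> (\<gamma> t) (\<gamma> s)"
      using lower[OF that] proj_angle_le_length_metric[of "\<gamma> t" "\<gamma> s"] unfolding proj_angle_commute[of "\<gamma> t"]
      by (meson ennreal_leI order_trans)
    have lip: "norm (\<gamma> (- u) - \<gamma> (- v)) \<le> \<theta> * \<bar>u - v\<bar>" if "u \<in> {- 1..0}" "v \<in> {- 1..0}" for u v
      using \<gamma>(4)[of "- u" "- v"] that by (simp add: abs_minus_commute)
    have "length_metric orth_projections ((\<lambda>r. \<gamma> (- r)) (- t)) ((\<lambda>r. \<gamma> (- r)) (- s)) \<le> ennreal (\<theta> * (- s - - t))"
      by (rule length_metric_lipschitz[OF _ \<theta>])
        (use that in \<open>auto intro: \<gamma>(3) lip\<close>)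
    then show "\<rho> (\<gamma> t) (\<gamma> s) \<le> ennreal (\<theta> * (t - s))" by simp
  qed
  show "\<exists>\<gamma>. geodesic_path orth_projections \<rho> P Q (proj_angle P Q) \<gamma>"
  \<comment> \<open>Reparametrising by arc length divides by \<open>\<theta>\<close>, so the
    constant path for \<open>P = Q\<close> is treated separately.\<close>
  proof (cases "\<theta> = 0")
    case True
    then have "P = Q" using sin_proj_angle[OF P Q] by (simp add: \<theta>_def)
    have "\<rho> P P = 0" using dist[of 0 0] \<gamma>(1) by simp
    then show ?thesis using \<open>P = Q\<close> True P unfolding geodesic_path_def
      by (intro exI[of _ "\<lambda>_. P"]) (auto simp: \<theta>_def)
  next
    case False
    then have \<theta>0: "0 < \<theta>" using \<theta> by simp
    define \<delta> where "\<delta> = (\<lambda>r. \<gamma> (r / \<theta>))"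
    have "\<rho> (\<delta> t) (\<delta> s) = ennreal \<bar>t - s\<bar>" if "s \<in> {0..\<theta>}" "t \<in> {0..\<theta>}" for s t
    proof -
      have unit: "0 \<le> s / \<theta>" "s / \<theta> \<le> 1" "0 \<le> t / \<theta>" "t / \<theta> \<le> 1" using that \<theta>0 by auto
      have diff: "\<theta> * (u / \<theta> - v / \<theta>) = u - v" for u v using \<theta>0 by (simp add: field_simps)
      show ?thesis
      proof (cases "s \<le> t")
        case True
        then have "s / \<theta> \<le> t / \<theta>" using \<theta>0 by (simp add: divide_right_mono)
        then show ?thesis using dist_rev[of "s / \<theta>" "t / \<theta>"] unit True by (simp add: \<delta>_def diff)
      next
        case False
        then have "t / \<theta> \<le> s / \<theta>" using \<theta>0 by (simp add: divide_right_mono)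
        then show ?thesis using dist[of "t / \<theta>" "s / \<theta>"] unit False by (simp add: \<delta>_def diff)
      qed
    qed
    then have "geodesic_path orth_projections \<rho> P Q \<theta> \<delta>"
      unfolding geodesic_path_def using \<theta>0 \<gamma>(1-3) by (auto simp: \<delta>_def)
    then show ?thesis unfolding \<theta>_def by blast
  qed
qed

text \<open>If the norm were 1, the angle \<open>pi / 2\<close> would already be a lower bound for
  the metric.\<close>

lemma length_metric_less_pi_half_iff:
  fixes P Q :: "'a::chilbert_space \<Rightarrow>\<^sub>L 'a"
  assumes P: "P \<in> orth_projections" and Q: "Q \<in> orth_projections"
  shows "\<rho> P Q < ennreal (pi / 2) \<longleftrightarrow> norm (P - Q) < 1"
proof
  assume "\<rho> P Q < ennreal (pi / 2)"
  then have "ennreal (proj_angle P Q) < ennreal (pi / 2)"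
    using proj_angle_le_length_metric by (rule le_less_trans[rotated])
  then have "proj_angle P Q < pi / 2" using proj_angle_bounds(1)[OF P Q] by (simp add: ennreal_less_iff)
  then have "norm (P - Q) \<noteq> 1" by (auto simp: proj_angle_def)
  then show "norm (P - Q) < 1" using norm_orth_projection_diff_le_1[OF P Q] by simp
next
  assume 1: "norm (P - Q) < 1"
  have "arcsin (norm (P - Q)) < arcsin 1"
    by (rule arcsin_less_arcsin) (use 1 norm_ge_zero[of "P - Q"] in \<open>linarith+\<close>)
  then have "proj_angle P Q < pi / 2" by (simp add: proj_angle_def)
  then have "ennreal (proj_angle P Q) < ennreal (pi / 2)" by (simp add: ennreal_lessI)
  then show "\<rho> P Q < ennreal (pi / 2)" using length_metric_le_proj_angle(2)[OF P Q 1] by (rule le_less_trans[rotated])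
qed

theorem theorem4p3:
  assumes "separable_space (euclidean :: 'a::chilbert_space topology)"
  shows "r_geodesic (ennreal (pi / 2)) (orth_projections :: ('a \<Rightarrow>\<^sub>L 'a) set) \<rho> \<and>
    (\<forall>P \<in> (orth_projections :: ('a \<Rightarrow>\<^sub>L 'a) set). \<forall>Q \<in> orth_projections.
       (\<rho> P Q < ennreal (pi / 2) \<longleftrightarrow> norm (P - Q) < 1) \<and>
       (norm (P - Q) < 1 \<longrightarrow>
          \<rho> P Q = ennreal (arcsin (norm (P - Q))) \<and>
          is_graph_subspace P Q \<and>
          \<rho> P Q = ennreal (norm (operator_angle P Q))))"
proof (intro conjI ballI impI)
  show "r_geodesic (ennreal (pi / 2)) (orth_projections :: ('a \<Rightarrow>\<^sub>L 'a) set) \<rho>"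
    unfolding r_geodesic_def
    using length_metric_less_pi_half_iff length_metric_le_proj_angle(1) by blast
next
  fix P Q :: "'a \<Rightarrow>\<^sub>L 'a"
  assume P: "P \<in> orth_projections" and Q: "Q \<in> orth_projections"
  show "\<rho> P Q < ennreal (pi / 2) \<longleftrightarrow> norm (P - Q) < 1"
    by (rule length_metric_less_pi_half_iff[OF P Q])
  assume less: "norm (P - Q) < 1"
  have eq: "\<rho> P Q = ennreal (proj_angle P Q)"
    by (rule antisym[OF length_metric_le_proj_angle(2)[OF P Q less] proj_angle_le_length_metric])
  then show "\<rho> P Q = ennreal (arcsin (norm (P - Q)))" by (simp add: proj_angle_def)
  interpret projection_pair P Q by unfold_locales (rule P Q less)+
  obtain X where X: "is_angular_operator P Q X" by (rule angular_operator_exists)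
  then show "is_graph_subspace P Q" unfolding is_graph_subspace_def by blast
  interpret angular_pair P Q X by unfold_locales (rule P Q X)+
  show "\<rho> P Q = ennreal (norm (operator_angle P Q))"
    using eq by (simp add: proj_angle_eq_arctan norm_operator_angle)
qed

end
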